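(* (i) For all $f\in\mathcal A$, pointwise on $X$, $$\Gamma_2(f)\ge R(f)+\|H_f\|_{HS}^2.$$ In particular, $R(f)(x)=-\infty$ if $\|H_f\|_{HS}(x)=+\infty$. (ii) Moreover, for $x\in X$, $f\in\mathcal A$ and $N\in[1,\infty)$ with $N\ge n(x):=\dim(\mathcal A,\Gamma)(x)$, $$\Gamma_2(f)(x)\ge R_N(f)(x)+\|H_f\|_{HS}^2(x)+\frac1{N-n(x)}\big(\mathrm{tr}\,H_f-Lf\big)^2(x)$$ $$=R_N(f)(x)+\frac1N(Lf)^2(x)+\Big\|H_f-\frac1N\,Lf\cdot\Gamma\Big\|_{HS}^2(x)+\frac1{N-n(x)}\Big(\mathrm{tr}\,H_f-\frac{n(x)}N\,Lf\Big)^2(x).$$ In the case $N=n(x)$ the respective last terms on the right-hand sides are understood as the limit $N\searrow n(x)$ (which is either $0$ or $+\infty$). (iii) Finally, for $x\in X$, $f\in\mathcal A$ and $N\in[1,\infty)$, $R_N(f)(x)=-\infty$ whenever $N<\dim(\mathcal A,\Gamma)(x)$, or if $N=\dim(\mathcal A,\Gamma)(x)$ and $\mathrm{tr}\,H_f(x)\ne Lf(x)$.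
   Context: Let $X$ be a set, $\mathcal A$ an algebra of real-valued functions on $X$ and $L:\mathcal A\to\mathcal A$ a linear operator. Put $\Gamma(f,g)=\frac12[L(fg)-fLg-gLf]$ and $\Gamma(f)=\Gamma(f,f)$. $L$ is assumed to be a diffusion operator: $\Gamma(f)\ge0$ for all $f\in\mathcal A$, and for all $r$, all $f_1,\dots,f_r\in\mathcal A$ and every $C^\infty$ function $\psi:\mathbb R^r\to\mathbb R$ with $\psi(0)=0$ one has $\psi(f_1,\dots,f_r)\in\mathcal A$ and $L\psi(f_1,\dots,f_r)=\sum_i\psi_i(f_1,\dots,f_r)\,Lf_i+\sum_{i,j}\psi_{ij}(f_1,\dots,f_r)\,\Gamma(f_i,f_j)$, where $\psi_i,\psi_{ij}$ are partial derivatives. $L,\Gamma$ are extended to the algebra generated by $\mathcal A$ and the constants by $L1=0$, $\Gamma(1,f)=0$. Define $\Gamma_2(f,g)=\frac12[L\Gamma(f,g)-\Gamma(f,Lg)-\Gamma(g,Lf)]$, $\Gamma_2(f)=\Gamma_2(f,f)$, the Hessian $H_f(g,h)=\frac12[\Gamma(g,\Gamma(f,h))+\Gamma(h,\Gamma(f,g))-\Gamma(f,\Gamma(g,h))]$, and for $N\in[1,\infty]$ (with $1/\infty=0$) the $N$-Ricci tensor $R_N(f)(x)=\inf\{\Gamma_2(\tilde f)(x)-\frac1N(L\tilde f)^2(x):\tilde f\in\mathcal A,\ \Gamma(\tilde f-f)(x)=0\}\in[-\infty,\infty)$; $R=R_\infty$. For $x\in X$, $\mathcal A^1_x$ is the quotient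 of $\mathcal A$ by $\{g:\Gamma(g)(x)=0\}$, with inner product $\Gamma(\cdot,\cdot)(x)$, and $\dim(\mathcal A,\Gamma)(x)\in\{0,1,\dots,\infty\}$ is its dimension. For a bilinear form $B$, evaluated on representatives, $\|B\|_{HS}(x)=\sup\{(\sum_{i,j=1}^rB(e_i,e_j)^2)^{1/2}:r\in\mathbb N,\ e_1,\dots,e_r\in\mathcal A,\ \Gamma(e_i,e_j)(x)=\delta_{ij}\}\in[0,\infty]$ (and $=0$ if $\dim(\mathcal A,\Gamma)(x)=0$). If $n=\dim(\mathcal A,\Gamma)(x)<\infty$, $\mathrm{tr}\,B=\sum_{i=1}^nB(e_i,e_i)$ for $e_1,\dots,e_n\in\mathcal A$ with $\Gamma(e_i,e_j)(x)=\delta_{ij}$. In norms and traces, $H_f$ and $\Gamma$ denote the bilinear forms $H_f(\cdot,\cdot)(x)$, $\Gamma(\cdot,\cdot)(x)$. If a term on a right-hand side is $+\infty$, inequalities $\Gamma_2\ge R_N+(\dots)$ are read as $R_N\le\Gamma_2-(\dots)$ in $[-\infty,\infty)$, and the equality of the two right-hand sides in (ii) is read as equality of the sums of the terms other than $R_N$. *)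

theory Defs
  imports "HOL-Analysis.Analysis"
begin

text \<open>
  The set \<open>X\<close> is the type \<open>'a\<close>. Operators such as \<open>L\<close> are total HOL functions;
  only their values on the algebra \<open>A\<close> are ever constrained or used.
\<close>

section \<open>Smooth functions on \<open>\<real>\<^sup>r\<close>\<close>

text \<open>
  Because \<open>r\<close> is quantified inside the definition of a diffusion operator, \<open>\<real>\<^sup>r\<close> is the
  library's \<open>Euclidean_space r\<close>: the functions \<open>u :: nat \<Rightarrow> real\<close> with \<open>u i = 0\<close> for all
  \<open>i \<ge> r\<close>, with the product topology.  The values of \<open>\<psi>\<close> outside this set are irrelevant.
\<close>

definition partial_deriv :: "nat \<Rightarrow> ((nat \<Rightarrow> real) \<Rightarrow> real) \<Rightarrow> (nat \<Rightarrow> real) \<Rightarrow> real" where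
  "partial_deriv i \<psi> u = deriv (\<lambda>t. \<psi> (u(i := t))) (u i)"

fun C_k :: "nat \<Rightarrow> nat \<Rightarrow> ((nat \<Rightarrow> real) \<Rightarrow> real) \<Rightarrow> bool" where
  "C_k r 0 \<psi> \<longleftrightarrow> continuous_map (Euclidean_space r) euclideanreal \<psi>"
| "C_k r (Suc k) \<psi> \<longleftrightarrow>
     continuous_map (Euclidean_space r) euclideanreal \<psi> \<and>
     (\<forall>i<r. (\<forall>u\<in>topspace (Euclidean_space r).
               (\<lambda>t. \<psi> (u(i := t))) field_differentiable at (u i)) \<and>
            C_k r k (partial_deriv i \<psi>))"

definition C_infinity :: "nat \<Rightarrow> ((nat \<Rightarrow> real) \<Rightarrow> real) \<Rightarrow> bool" where
  "C_infinity r \<psi> \<longleftrightarrow> (\<forall>k. C_k r k \<psi>)"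

definition tuple :: "nat \<Rightarrow> (nat \<Rightarrow> 'a \<Rightarrow> real) \<Rightarrow> 'a \<Rightarrow> (nat \<Rightarrow> real)" where
  "tuple r f x = (\<lambda>i. if i < r then f i x else 0)"


section \<open>Diffusion operators\<close>

definition \<Gamma> :: "(('a \<Rightarrow> real) \<Rightarrow> 'a \<Rightarrow> real) \<Rightarrow> ('a \<Rightarrow> real) \<Rightarrow> ('a \<Rightarrow> real) \<Rightarrow> 'a \<Rightarrow> real" where
  "\<Gamma> L f g = (\<lambda>x. (L (\<lambda>y. f y * g y) x - f x * L g x - g x * L f x) / 2)"

locale function_algebra =
  fixes A :: "('a \<Rightarrow> real) set"
  assumes zero_mem: "(\<lambda>x. 0) \<in> A"
    and add_mem: "\<And>f g. f \<in> A \<Longrightarrow> g \<in> A \<Longrightarrow> (\<lambda>x. f x + g x) \<in> A"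
    and scale_mem: "\<And>c f. f \<in> A \<Longrightarrow> (\<lambda>x. c * f x) \<in> A"
    and mult_mem: "\<And>f g. f \<in> A \<Longrightarrow> g \<in> A \<Longrightarrow> (\<lambda>x. f x * g x) \<in> A"

locale diffusion_operator = function_algebra A
  for A :: "('a \<Rightarrow> real) set" and L :: "('a \<Rightarrow> real) \<Rightarrow> 'a \<Rightarrow> real" +
  assumes L_mem: "\<And>f. f \<in> A \<Longrightarrow> L f \<in> A"
    and L_add: "\<And>f g. f \<in> A \<Longrightarrow> g \<in> A \<Longrightarrow> L (\<lambda>x. f x + g x) = (\<lambda>x. L f x + L g x)"
    and L_scale: "\<And>c f. f \<in> A \<Longrightarrow> L (\<lambda>x. c * f x) = (\<lambda>x. c * L f x)"
    and Gamma_nonneg: "\<And>f x. f \<in> A \<Longrightarrow> \<Gamma> L f f x \<ge> 0"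
    and comp_mem: "\<And>r f \<psi>. (\<And>i. i < r \<Longrightarrow> f i \<in> A) \<Longrightarrow> C_infinity r \<psi> \<Longrightarrow> \<psi> (\<lambda>_. 0) = 0 \<Longrightarrow>
            (\<lambda>x. \<psi> (tuple r f x)) \<in> A"
    and L_comp: "\<And>r f \<psi>. (\<And>i. i < r \<Longrightarrow> f i \<in> A) \<Longrightarrow> C_infinity r \<psi> \<Longrightarrow> \<psi> (\<lambda>_. 0) = 0 \<Longrightarrow>
            L (\<lambda>x. \<psi> (tuple r f x)) =
              (\<lambda>x. (\<Sum>i<r. partial_deriv i \<psi> (tuple r f x) * L (f i) x)
                 + (\<Sum>i<r. \<Sum>j<r. partial_deriv j (partial_deriv i \<psi>) (tuple r f x)
                                  * \<Gamma> L (f i) (f j) x))"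

definition \<Gamma>2 :: "(('a \<Rightarrow> real) \<Rightarrow> 'a \<Rightarrow> real) \<Rightarrow> ('a \<Rightarrow> real) \<Rightarrow> ('a \<Rightarrow> real) \<Rightarrow> 'a \<Rightarrow> real" where
  "\<Gamma>2 L f g = (\<lambda>x. (L (\<Gamma> L f g) x - \<Gamma> L f (L g) x - \<Gamma> L g (L f) x) / 2)"

definition Hess ::
    "(('a \<Rightarrow> real) \<Rightarrow> 'a \<Rightarrow> real) \<Rightarrow> ('a \<Rightarrow> real) \<Rightarrow> ('a \<Rightarrow> real) \<Rightarrow> ('a \<Rightarrow> real) \<Rightarrow> 'a \<Rightarrow> real" where
  "Hess L f g h = (\<lambda>x. (\<Gamma> L g (\<Gamma> L f h) x + \<Gamma> L h (\<Gamma> L f g) x - \<Gamma> L f (\<Gamma> L g h) x) / 2)"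

text \<open>The infimum is taken in \<open>ereal\<close>, where \<open>1 / \<infinity> = 0\<close>.\<close>

definition Ricci ::
    "('a \<Rightarrow> real) set \<Rightarrow> (('a \<Rightarrow> real) \<Rightarrow> 'a \<Rightarrow> real) \<Rightarrow> ereal \<Rightarrow> ('a \<Rightarrow> real) \<Rightarrow> 'a \<Rightarrow> ereal" where
  "Ricci A L N f x =
     (INF g\<in>{g \<in> A. \<Gamma> L (\<lambda>y. g y - f y) (\<lambda>y. g y - f y) x = 0}.
        ereal (\<Gamma>2 L g g x - real_of_ereal (1 / N) * (L g x)\<^sup>2))"


section \<open>The tangent space at a point\<close>

text \<open>
  Linear independence of (the classes of) \<open>e 0, \<dots>, e (r - 1)\<close> in the quotient of \<open>A\<close> by
  \<open>{g. \<Gamma>(g)(x) = 0}\<close>: a linear combination has class zero only if all coefficients vanish.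
\<close>

definition independent_at ::
    "('a \<Rightarrow> real) set \<Rightarrow> (('a \<Rightarrow> real) \<Rightarrow> 'a \<Rightarrow> real) \<Rightarrow> 'a \<Rightarrow> nat \<Rightarrow> (nat \<Rightarrow> 'a \<Rightarrow> real) \<Rightarrow> bool" where
  "independent_at A L x r e \<longleftrightarrow>
     (\<forall>i<r. e i \<in> A) \<and>
     (\<forall>c :: nat \<Rightarrow> real.
        \<Gamma> L (\<lambda>y. \<Sum>i<r. c i * e i y) (\<lambda>y. \<Sum>i<r. c i * e i y) x = 0 \<longrightarrow> (\<forall>i<r. c i = 0))"

definition dim_at :: "('a \<Rightarrow> real) set \<Rightarrow> (('a \<Rightarrow> real) \<Rightarrow> 'a \<Rightarrow> real) \<Rightarrow> 'a \<Rightarrow> enat" where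
  "dim_at A L x = Sup {enat r | r. \<exists>e. independent_at A L x r e}"

definition orthonormal_at ::
    "('a \<Rightarrow> real) set \<Rightarrow> (('a \<Rightarrow> real) \<Rightarrow> 'a \<Rightarrow> real) \<Rightarrow> 'a \<Rightarrow> nat \<Rightarrow> (nat \<Rightarrow> 'a \<Rightarrow> real) \<Rightarrow> bool" where
  "orthonormal_at A L x r e \<longleftrightarrow>
     (\<forall>i<r. e i \<in> A) \<and> (\<forall>i<r. \<forall>j<r. \<Gamma> L (e i) (e j) x = (if i = j then 1 else 0))"

text \<open>
  The empty family \<open>r = 0\<close> is admitted; it contributes \<open>0\<close>, so the supremum is \<open>0\<close> when
  the tangent space is trivial.
\<close>

definition HS_norm ::
    "('a \<Rightarrow> real) set \<Rightarrow> (('a \<Rightarrow> real) \<Rightarrow> 'a \<Rightarrow> real) \<Rightarrow> 'a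
      \<Rightarrow> (('a \<Rightarrow> real) \<Rightarrow> ('a \<Rightarrow> real) \<Rightarrow> real) \<Rightarrow> ereal" where
  "HS_norm A L x B =
     Sup {ereal (sqrt (\<Sum>i<r. \<Sum>j<r. (B (e i) (e j))\<^sup>2)) | r e. orthonormal_at A L x r e}"

text \<open>
  The trace with respect to an orthonormal family of length \<open>n\<close>.  The form \<open>H\<^sub>f\<close> need not
  descend to the quotient (it does not for the sub-Laplacian of the Heisenberg group), so the sum may depend on the
  representatives \<open>e\<close>; statements about the trace are therefore made for every such \<open>e\<close>,
  where \<open>n\<close> is the dimension.  Existence is lemma \<open>ex_orthonormal_at\<close>.
\<close>

definition trace_along ::
    "nat \<Rightarrow> (nat \<Rightarrow> 'a \<Rightarrow> real) \<Rightarrow> (('a \<Rightarrow> real) \<Rightarrow> ('a \<Rightarrow> real) \<Rightarrow> real) \<Rightarrow> real" where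
  "trace_along n e B = (\<Sum>i<n. B (e i) (e i))"

text \<open>The value \<open>\<phi> N\<close>, understood as the limit from the right (in \<open>ereal\<close>) if \<open>N = n\<close>.\<close>

definition value_or_limit :: "nat \<Rightarrow> real \<Rightarrow> (real \<Rightarrow> real) \<Rightarrow> ereal" where
  "value_or_limit n N \<phi> =
     (if N = real n then Lim (at_right (real n)) (\<lambda>M. ereal (\<phi> M)) else ereal (\<phi> N))"

context diffusion_operator
begin

lemma sum_mem:
  fixes r :: nat
  shows "(\<And>i. i < r \<Longrightarrow> e i \<in> A) \<Longrightarrow> (\<lambda>y. \<Sum>i<r. c i * e i y) \<in> A"
  by (induction r) (auto simp: zero_mem intro!: add_mem scale_mem)

lemma Gamma_sym: "\<Gamma> L f g = \<Gamma> L g f"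
  by (simp add: \<Gamma>_def mult.commute algebra_simps)

lemma Gamma_add:
  assumes "f \<in> A" "g \<in> A" "h \<in> A"
  shows "\<Gamma> L (\<lambda>y. f y + g y) h x = \<Gamma> L f h x + \<Gamma> L g h x"
proof -
  have "L (\<lambda>y. (f y + g y) * h y) = (\<lambda>x. L (\<lambda>y. f y * h y) x + L (\<lambda>y. g y * h y) x)"
    using L_add[of "\<lambda>y. f y * h y" "\<lambda>y. g y * h y"] assms
    by (simp add: mult_mem distrib_right)
  then show ?thesis
    using assms by (simp add: \<Gamma>_def L_add field_simps)
qed

lemma Gamma_scale:
  assumes "f \<in> A" "h \<in> A"
  shows "\<Gamma> L (\<lambda>y. c * f y) h x = c * \<Gamma> L f h x"
proof -
  have "L (\<lambda>y. c * f y * h y) = (\<lambda>x. c * L (\<lambda>y. f y * h y) x)"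
    using L_scale[of "\<lambda>y. f y * h y" c] assms by (simp add: mult_mem mult.assoc)
  then show ?thesis
    using assms by (simp add: \<Gamma>_def L_scale field_simps)
qed

lemma Gamma_sum:
  fixes r :: nat
  assumes "h \<in> A"
  shows "(\<And>i. i < r \<Longrightarrow> e i \<in> A) \<Longrightarrow>
    \<Gamma> L (\<lambda>y. \<Sum>i<r. c i * e i y) h x = (\<Sum>i<r. c i * \<Gamma> L (e i) h x)"
proof (induction r)
  case 0
  show ?case using Gamma_scale[OF assms assms, of 0 x] by simp
next
  case (Suc r)
  then show ?case
    using assms by (simp add: Gamma_add Gamma_scale sum_mem scale_mem)
qed

lemma gram_schmidt:
  assumes "independent_at A L x r e" "m \<le> r"
  shows "\<exists>u a. orthonormal_at A L x m u \<and> (\<forall>i<m. u i = (\<lambda>y. \<Sum>j<m. a i j * e j y))"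
  using assms(2)
proof (induction m)
  case 0
  show ?case by (simp add: orthonormal_at_def)
next
  case (Suc m)
  then obtain u a where u: "orthonormal_at A L x m u"
    and a: "\<forall>i<m. u i = (\<lambda>y. \<Sum>j<m. a i j * e j y)" by auto
  have eA: "e i \<in> A" if "i < r" for i
    using assms(1) that by (auto simp: independent_at_def)
  have uA: "u i \<in> A" if "i < m" for i using u that by (auto simp: orthonormal_at_def)
  have em: "e m \<in> A" using eA Suc.prems by auto
  define s where "s i = - \<Gamma> L (u i) (e m) x" for i
  define w where "w = (\<lambda>y. \<Sum>i<m. s i * u i y)"
  have wA: "w \<in> A" unfolding w_def by (intro sum_mem uA)
  define v where "v = (\<lambda>y. e m y + w y)"
  have vA: "v \<in> A" unfolding v_def by (intro add_mem em wA)
  have vu: "\<Gamma> L v (u k) x = 0" if k: "k < m" for k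
  proof -
    have "\<Gamma> L w (u k) x = (\<Sum>i<m. s i * \<Gamma> L (u i) (u k) x)"
      unfolding w_def using uA k by (intro Gamma_sum) auto
    also have "\<dots> = (\<Sum>i<m. if i = k then s i else 0)"
      using u k by (intro sum.cong) (auto simp: orthonormal_at_def)
    also have "\<dots> = s k" using k by simp
    finally show ?thesis
      unfolding v_def using Gamma_add[OF em wA uA[OF k], of x]
      by (simp add: s_def Gamma_sym[of "u k" "e m"])
  qed
  define b where "b j = (if j = m then 1 else \<Sum>i<m. s i * a i j)" for j
  have w_eq: "w y = (\<Sum>j<m. b j * e j y)" for y
  proof -
    have "w y = (\<Sum>i<m. \<Sum>j<m. s i * a i j * e j y)"
      unfolding w_def using a by (intro sum.cong) (auto simp: sum_distrib_left mult.assoc)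
    also have "\<dots> = (\<Sum>j<m. \<Sum>i<m. s i * a i j * e j y)" by (rule sum.swap)
    also have "\<dots> = (\<Sum>j<m. b j * e j y)"
      by (intro sum.cong) (auto simp: b_def sum_distrib_right)
    finally show ?thesis .
  qed
  have v_eq: "v = (\<lambda>y. \<Sum>j<Suc m. b j * e j y)"
    by (simp add: v_def w_eq b_def fun_eq_iff)
  have v_ne: "\<Gamma> L v v x \<noteq> 0"
  proof
    assume v0: "\<Gamma> L v v x = 0"
    define c where "c j = (if j \<le> m then b j else 0)" for j
    have "(\<Sum>j<r. c j * e j y) = (\<Sum>j<Suc m. b j * e j y)" for y
      using Suc.prems by (intro sum.mono_neutral_cong_right) (auto simp: c_def)
    then have "v = (\<lambda>y. \<Sum>j<r. c j * e j y)" by (simp add: v_eq)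
    then have "\<forall>i<r. c i = 0" using assms(1) v0 by (auto simp: independent_at_def)
    then show False using Suc.prems by (auto simp: c_def b_def dest!: spec[of _ m])
  qed
  define q where "q = \<Gamma> L v v x"
  have q: "q > 0" using v_ne Gamma_nonneg[OF vA, of x] by (simp add: q_def)
  define t where "t = 1 / sqrt q"
  define z where "z = (\<lambda>y. t * v y)"
  have zA: "z \<in> A" unfolding z_def by (intro scale_mem vA)
  have zz: "\<Gamma> L z z x = 1"
  proof -
    have "\<Gamma> L z z x = t * (t * q)"
      using Gamma_scale[OF vA zA, of t x] Gamma_scale[OF vA vA, of t x]
      by (simp add: z_def q_def Gamma_sym)
    also have "\<dots> = 1" using q by (simp add: t_def)
    finally show ?thesis .
  qed
  have zu: "\<Gamma> L z (u k) x = 0" if "k < m" for k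
    using Gamma_scale[OF vA uA[OF that], of t x] vu[OF that] by (simp add: z_def)
  have uz: "\<Gamma> L (u k) z x = 0" if "k < m" for k
    using zu[OF that] Gamma_sym by metis
  define u' where "u' i = (if i = m then z else u i)" for i
  define a' where "a' i j = (if i = m then t * b j else if j = m then 0 else a i j)" for i j
  have "orthonormal_at A L x (Suc m) u'"
    using u zA zz zu uz by (auto simp: orthonormal_at_def u'_def less_Suc_eq)
  moreover have "\<forall>i<Suc m. u' i = (\<lambda>y. \<Sum>j<Suc m. a' i j * e j y)"
  proof (intro allI impI ext)
    fix i y assume i: "i < Suc m"
    show "u' i y = (\<Sum>j<Suc m. a' i j * e j y)"
    proof (cases "i = m")
      case True
      then show ?thesis
        by (simp add: u'_def a'_def z_def v_eq sum_distrib_left distrib_left mult.assoc)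
    next
      case False
      then show ?thesis using i a by (simp add: u'_def a'_def)
    qed
  qed
  ultimately show ?case by blast
qed

lemma ex_orthonormal_at:
  assumes "dim_at A L x = enat n"
  shows "\<exists>e. orthonormal_at A L x n e"
proof -
  let ?S = "{enat r | r. \<exists>e. independent_at A L x r e}"
  have "independent_at A L x 0 (\<lambda>_ _. 0)" by (simp add: independent_at_def)
  then have ne: "?S \<noteq> {}" by blast
  have "finite ?S"
    using assms ne by (auto simp: dim_at_def Sup_enat_def split: if_splits)
  then have "Max ?S \<in> ?S" using ne by (rule Max_in)
  moreover have "Sup ?S = Max ?S"
    using ne \<open>finite ?S\<close> by (subst Sup_enat_def) (simp only: if_False if_True)
  ultimately have "Sup ?S \<in> ?S" by (simp only:)
  then obtain r e where r: "Sup ?S = enat r" "independent_at A L x r e" by blast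
  then have "r = n" using assms by (simp add: dim_at_def)
  with r have "independent_at A L x n e" by simp
  then show ?thesis using gram_schmidt[of x n e n] by auto
qed

end

end

theory Submission
  imports Defs
begin

text \<open>
  The function \<open>f\<close> may be modified by functions \<open>w\<close> with \<open>\<Gamma>(w)(x) = 0\<close> without changing
  \<open>R\<^sub>N(f)(x)\<close>, so every such \<open>w\<close> gives the upper bound
  \<open>R\<^sub>N(f)(x) \<le> \<Gamma>\<^sub>2(f + w)(x) - (L(f + w)(x))\<^sup>2 / N\<close>.  The inequalities come from
  functions \<open>w\<close> that vanish to second order at \<open>x\<close>.  If \<open>e\<^sub>1, \<dots>, e\<^sub>r\<close> are orthonormal at
  \<open>x\<close>, \<open>a\<close> is a symmetric matrix and
  \<open>w = \<Sum> a\<^sub>i\<^sub>j (e\<^sub>i - e\<^sub>i(x)) (e\<^sub>j - e\<^sub>j(x)) / 2\<close> up to an additive constant, then at \<open>x\<close>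
  one has \<open>\<Gamma>(w, \<cdot>) = 0\<close>, \<open>L w = tr a\<close>, \<open>\<Gamma>\<^sub>2(f, w) = \<Sum> a\<^sub>i\<^sub>j H\<^sub>f(e\<^sub>i, e\<^sub>j)\<close> and
  \<open>\<Gamma>\<^sub>2(w) = \<Sum> a\<^sub>i\<^sub>j\<^sup>2\<close>, hence (\<open>Ricci_le_frame\<close>)
  \<open>R\<^sub>N(f) \<le> \<Gamma>\<^sub>2(f) + 2 \<Sum> a\<^sub>i\<^sub>j H\<^sub>f(e\<^sub>i, e\<^sub>j) + \<Sum> a\<^sub>i\<^sub>j\<^sup>2 - (L f + tr a)\<^sup>2 / N\<close>.
  Everything follows from the choice \<open>a = c I - H\<^sub>f\<close> with a real \<open>c\<close>
  (\<open>Ricci_le_shifted_Hess\<close>): \<open>c = 0\<close> gives (i), the minimising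
  \<open>c = (L f - tr H\<^sub>f) / (N - n)\<close> gives (ii), and in (iii) the bound is a quadratic polynomial in
  \<open>c\<close> that is unbounded below.

  These identities at \<open>x\<close> are pure algebra once \<open>\<Gamma>\<close> is a derivation in each argument
  (\<open>Gamma_mult\<close>), and this is the chain rule for \<open>\<psi>(u) = u\<^sub>0 u\<^sub>1 u\<^sub>2\<close> (\<open>cubic_chain_rule\<close>).

  The delicate point is that \<open>H\<^sub>f(\<cdot>, \<cdot>)(x)\<close> need not be well defined on the tangent space.
  If \<open>H\<^sub>f(g, h)(x) \<noteq> 0\<close> for some \<open>g\<close> with \<open>\<Gamma>(g)(x) = 0\<close>, then perturbing \<open>f\<close> by multiples
  \<open>t (g - g(x)) (h - h(x))\<close> changes \<open>\<Gamma>\<^sub>2(f)(x)\<close> by a nonzero multiple of \<open>t\<close> and leaves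
  \<open>L f(x)\<close> fixed, so
  \<open>R\<^sub>N(f)(x) = -\<infinity>\<close> (\<open>Ricci_eq_MInfty_degenerate\<close>); if moreover the dimension is positive,
  both Hilbert-Schmidt norms in (ii) are infinite (\<open>HS_norm_eq_PInfty\<close>), so the two right-hand
  sides agree.  In the remaining cases, by Bessel's inequality, the Hilbert-Schmidt norms are Frobenius norms
  with respect to any orthonormal frame of maximal length (\<open>HS_norm_eq_Frobenius\<close>), and the
  equality in (ii) is an identity between real numbers (\<open>completed_square_identity\<close>).
\<close>

section \<open>Polynomials are smooth\<close>

inductive polynomial_map :: "((nat \<Rightarrow> real) \<Rightarrow> real) \<Rightarrow> bool" where
  const: "polynomial_map (\<lambda>u. c)"
| coordinate: "polynomial_map (\<lambda>u. u i)"
| add: "polynomial_map p \<Longrightarrow> polynomial_map q \<Longrightarrow> polynomial_map (\<lambda>u. p u + q u)"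
| mult: "polynomial_map p \<Longrightarrow> polynomial_map q \<Longrightarrow> polynomial_map (\<lambda>u. p u * q u)"

lemma polynomial_map_continuous:
  "polynomial_map p \<Longrightarrow> continuous_map (Euclidean_space r) euclideanreal p"
proof (induction rule: polynomial_map.induct)
  case (coordinate i)
  have "continuous_map (powertop_real (UNIV :: nat set)) euclideanreal (\<lambda>u. u i)"
    using continuous_map_product_projection[of i UNIV "\<lambda>_. euclideanreal"] by simp
  then show ?case
    unfolding Euclidean_space_def by (rule continuous_map_from_subtopology)
qed (auto intro: continuous_map_add continuous_map_real_mult)

text \<open>
  The derivative is given as a polynomial on all of \<open>nat \<Rightarrow> real\<close>, so that the class is closed
  under \<open>partial_deriv\<close> as an equality of functions; smoothness then follows by induction on the
  order.
\<close>

lemma polynomial_map_partial_derivative: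
  "polynomial_map p \<Longrightarrow>
    \<exists>p'. polynomial_map p' \<and>
      (\<forall>u. ((\<lambda>t. p (u(i := t))) has_field_derivative p' u) (at (u i)))"
proof (induction rule: polynomial_map.induct)
  case (const c)
  show ?case
    by (rule exI[of _ "\<lambda>u. 0"]) (auto intro: polynomial_map.const)
next
  case (coordinate k)
  show ?case
    by (rule exI[of _ "\<lambda>u. if k = i then 1 else 0"])
      (auto intro: polynomial_map.const)
next
  case (add p q)
  then obtain p' q' where
    p: "polynomial_map p'" "\<And>u. ((\<lambda>t. p (u(i := t))) has_field_derivative p' u) (at (u i))" and
    q: "polynomial_map q'" "\<And>u. ((\<lambda>t. q (u(i := t))) has_field_derivative q' u) (at (u i))"
    by blast
  show ?case
    by (intro exI[of _ "\<lambda>u. p' u + q' u"] conjI allI polynomial_map.add DERIV_add p q)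
next
  case (mult p q)
  then obtain p' q' where
    p: "polynomial_map p'" "\<And>u. ((\<lambda>t. p (u(i := t))) has_field_derivative p' u) (at (u i))" and
    q: "polynomial_map q'" "\<And>u. ((\<lambda>t. q (u(i := t))) has_field_derivative q' u) (at (u i))"
    by blast
  have "((\<lambda>t. p (u(i := t)) * q (u(i := t))) has_field_derivative p' u * q u + q' u * p u)
      (at (u i))" for u
    using DERIV_mult[OF p(2)[of u] q(2)[of u]] by simp
  then show ?case
    by (intro exI[of _ "\<lambda>u. p' u * q u + q' u * p u"] conjI allI polynomial_map.add
        polynomial_map.mult p(1) q(1) mult.hyps)
qed

lemma polynomial_map_C_infinity:
  assumes "polynomial_map p"
  shows "C_infinity r p"
proof -
  have "C_k r k p" if "polynomial_map p" for k p
    using that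
  proof (induction k arbitrary: p)
    case 0
    then show ?case by (simp add: polynomial_map_continuous)
  next
    case (Suc k)
    have "(\<forall>u\<in>topspace (Euclidean_space r). (\<lambda>t. p (u(i := t))) field_differentiable at (u i)) \<and>
        C_k r k (partial_deriv i p)" for i
    proof -
      obtain p' where p': "polynomial_map p'"
        "\<And>u. ((\<lambda>t. p (u(i := t))) has_field_derivative p' u) (at (u i))"
        using polynomial_map_partial_derivative[OF Suc.prems, of i] by blast
      then have "partial_deriv i p = p'"
        by (auto simp: partial_deriv_def fun_eq_iff intro!: DERIV_imp_deriv)
      with p' show ?thesis
        using Suc.IH by (auto simp: field_differentiable_def)
    qed
    then show ?case
      using Suc.prems by (simp add: polynomial_map_continuous)
  qed
  with assms show ?thesis by (simp add: C_infinity_def)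
qed


section \<open>Quadratic functions of one real variable\<close>

text \<open>
  Averaging the values at \<open>t\<close> and \<open>-t\<close> removes the linear term.
\<close>

lemma quadratic_bounded_below:
  fixes p q s K :: real
  assumes "\<And>t. K \<le> p + q * t + s * t\<^sup>2"
  shows "0 \<le> s" and "s = 0 \<Longrightarrow> q = 0"
proof -
  have ps: "K \<le> p + s * t\<^sup>2" for t
    using assms[of t] assms[of "- t"] by simp
  show "0 \<le> s"
  proof (rule ccontr)
    assume s: "\<not> 0 \<le> s"
    define t where "t = sqrt (\<bar>p - K\<bar> / (- s) + 1)"
    have "0 \<le> \<bar>p - K\<bar> / (- s)" using s by (intro divide_nonneg_nonneg) auto
    then have "t\<^sup>2 = \<bar>p - K\<bar> / (- s) + 1" by (simp add: t_def)
    then have "s * t\<^sup>2 = s - \<bar>p - K\<bar>" using s by (simp add: field_simps)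
    then show False using ps[of t] s by linarith
  qed
  show "q = 0" if "s = 0"
  proof (rule ccontr)
    assume "q \<noteq> 0"
    then show False using assms[of "(K - 1 - p) / q"] that by simp
  qed
qed

lemma ereal_below_unbounded_quadratic:
  fixes R :: ereal and p q s :: real
  assumes le: "\<And>t. R \<le> ereal (p + q * t + s * t\<^sup>2)"
    and "s < 0 \<or> (s = 0 \<and> q \<noteq> 0)"
  shows "R = -\<infinity>"
proof (cases R)
  case (real \<rho>)
  then have "\<And>t. \<rho> \<le> p + q * t + s * t\<^sup>2" using le by simp
  from quadratic_bounded_below[OF this] assms(2) show ?thesis by auto
next
  case PInf
  then show ?thesis using le[of 0] by simp
qed


section \<open>Calculus of a diffusion operator\<close>

context diffusion_operator
begin

text \<open>
  With \<open>L (f g)\<close> rewritten through \<open>\<Gamma>(f, g)\<close>, this formula becomes the Leibniz rule for \<open>\<Gamma>\<close>.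
\<close>

lemma cubic_chain_rule:
  assumes "f \<in> A" "g \<in> A" "h \<in> A"
  shows "L (\<lambda>y. f y * g y * h y) x =
    g x * h x * L f x + f x * h x * L g x + f x * g x * L h x +
    2 * (h x * \<Gamma> L f g x + g x * \<Gamma> L f h x + f x * \<Gamma> L g h x)"
proof -
  define F where "F i = (if i = 0 then f else if i = 1 then g else h)" for i :: nat
  define \<psi> :: "(nat \<Rightarrow> real) \<Rightarrow> real" where "\<psi> u = u 0 * u 1 * u 2" for u
  have \<psi>: "C_infinity 3 \<psi>"
    unfolding \<psi>_def[abs_def] by (intro polynomial_map_C_infinity polynomial_map.intros)
  have FA: "F i \<in> A" for i using assms by (simp add: F_def)
  have d: "partial_deriv 0 \<psi> = (\<lambda>u. u 1 * u 2)" "partial_deriv 1 \<psi> = (\<lambda>u. u 0 * u 2)"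
    "partial_deriv 2 \<psi> = (\<lambda>u. u 0 * u 1)"
    by (auto simp: partial_deriv_def \<psi>_def fun_eq_iff intro!: DERIV_imp_deriv derivative_eq_intros)
  have dd: "partial_deriv i (\<lambda>u. u j * u k) =
      (\<lambda>u. (if j = i then u k else 0) + (if k = i then u j else 0))" for i j k
    by (auto simp: partial_deriv_def fun_eq_iff power2_eq_square
        intro!: DERIV_imp_deriv derivative_eq_intros)
  have sum3: "(\<Sum>i<3. T i) = T 0 + T 1 + T 2" for T :: "nat \<Rightarrow> real"
    by (simp add: eval_nat_numeral)
  have "L (\<lambda>y. \<psi> (tuple 3 F y)) x =
      (\<Sum>i<3. partial_deriv i \<psi> (tuple 3 F x) * L (F i) x) +
      (\<Sum>i<3. \<Sum>j<3. partial_deriv j (partial_deriv i \<psi>) (tuple 3 F x) * \<Gamma> L (F i) (F j) x)"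
    using L_comp[of 3 F \<psi>] FA \<psi> by (simp add: \<psi>_def)
  moreover have "(\<lambda>y. \<psi> (tuple 3 F y)) = (\<lambda>y. f y * g y * h y)"
    by (simp add: \<psi>_def tuple_def F_def fun_eq_iff)
  ultimately show ?thesis
    by (simp add: sum3 d dd tuple_def F_def Gamma_sym[of g f] Gamma_sym[of h f] Gamma_sym[of h g]
        algebra_simps del: One_nat_def)
qed

lemma Gamma_mult:
  assumes "f \<in> A" "g \<in> A" "h \<in> A"
  shows "\<Gamma> L (\<lambda>y. f y * g y) h x = f x * \<Gamma> L g h x + g x * \<Gamma> L f h x"
proof -
  have "L (\<lambda>y. f y * g y) x = 2 * \<Gamma> L f g x + f x * L g x + g x * L f x"
    by (simp add: \<Gamma>_def field_simps)
  with cubic_chain_rule[OF assms, of x] show ?thesis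
    unfolding \<Gamma>_def[of L "\<lambda>y. f y * g y" h] by (simp add: algebra_simps)
qed


declare L_mem [simp]

lemma Gamma_mem [simp]:
  assumes "f \<in> A" "g \<in> A"
  shows "\<Gamma> L f g \<in> A"
proof -
  have "(\<lambda>x. (1/2) * (L (\<lambda>y. f y * g y) x + (- 1) * (f x * L g x + g x * L f x))) \<in> A"
    using assms by (intro scale_mem add_mem mult_mem L_mem)
  also have "(\<lambda>x. (1/2) * (L (\<lambda>y. f y * g y) x + (- 1) * (f x * L g x + g x * L f x))) = \<Gamma> L f g"
    by (auto simp: \<Gamma>_def fun_eq_iff field_simps)
  finally show ?thesis .
qed

lemma Gamma_bilinear:
  assumes "f \<in> A" "g \<in> A" "h \<in> A"
  shows "\<Gamma> L (\<lambda>y. f y + g y) h = (\<lambda>x. \<Gamma> L f h x + \<Gamma> L g h x)"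
    and "\<Gamma> L h (\<lambda>y. f y + g y) = (\<lambda>x. \<Gamma> L h f x + \<Gamma> L h g x)"
    and "\<Gamma> L (\<lambda>y. c * f y) h = (\<lambda>x. c * \<Gamma> L f h x)"
    and "\<Gamma> L h (\<lambda>y. c * f y) = (\<lambda>x. c * \<Gamma> L h f x)"
  using assms
  by (auto simp: Gamma_add Gamma_scale Gamma_sym[of h] fun_eq_iff)

text \<open>
  The values \<open>L f x\<close>, \<open>\<Gamma>(f, h)(x)\<close>, \<open>\<Gamma>\<^sub>2(f, h)(x)\<close> and \<open>H\<^sub>f(g, h)(x)\<close> all depend linearly on
  \<open>f \<in> A\<close>; a common name for this lets finite sums be pulled out of all of them at once.
\<close>

definition functional :: "(('a \<Rightarrow> real) \<Rightarrow> real) \<Rightarrow> bool" where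
  "functional T \<longleftrightarrow>
    (\<forall>f\<in>A. \<forall>g\<in>A. T (\<lambda>y. f y + g y) = T f + T g) \<and>
    (\<forall>c. \<forall>f\<in>A. T (\<lambda>y. c * f y) = c * T f)"

lemma functional_add: "functional T \<Longrightarrow> f \<in> A \<Longrightarrow> g \<in> A \<Longrightarrow> T (\<lambda>y. f y + g y) = T f + T g"
  and functional_scale: "functional T \<Longrightarrow> f \<in> A \<Longrightarrow> T (\<lambda>y. c * f y) = c * T f"
  by (auto simp: functional_def)

lemma functional_sum:
  fixes r :: nat
  assumes "functional T"
  shows "(\<And>i. i < r \<Longrightarrow> e i \<in> A) \<Longrightarrow> T (\<lambda>y. \<Sum>i<r. c i * e i y) = (\<Sum>i<r. c i * T (e i))"
proof (induction r)
  case 0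
  show ?case using functional_scale[OF assms zero_mem, of 0] by simp
next
  case (Suc r)
  then show ?case
    using functional_add[OF assms sum_mem[of r e c] scale_mem[of "e r" "c r"]]
    by (simp add: functional_scale[OF assms])
qed

lemma functional_double_sum:
  fixes r :: nat
  assumes T: "functional T" and q: "\<And>i j. i < r \<Longrightarrow> j < r \<Longrightarrow> q i j \<in> A"
  shows "T (\<lambda>y. \<Sum>i<r. \<Sum>j<r. c i j * q i j y) = (\<Sum>i<r. \<Sum>j<r. c i j * T (q i j))"
    and "(\<lambda>y. \<Sum>i<r. \<Sum>j<r. c i j * q i j y) \<in> A"
proof -
  define Q where "Q i = (\<lambda>y. \<Sum>j<r. c i j * q i j y)" for i
  have Q: "Q i \<in> A" "T (Q i) = (\<Sum>j<r. c i j * T (q i j))" if "i < r" for i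
    unfolding Q_def using that q by (auto intro!: sum_mem functional_sum[OF T])
  show "T (\<lambda>y. \<Sum>i<r. \<Sum>j<r. c i j * q i j y) = (\<Sum>i<r. \<Sum>j<r. c i j * T (q i j))"
    using functional_sum[OF T, of r Q "\<lambda>_. 1"] Q by (simp add: Q_def)
  show "(\<lambda>y. \<Sum>i<r. \<Sum>j<r. c i j * q i j y) \<in> A"
    using sum_mem[of r Q "\<lambda>_. 1"] Q by (simp add: Q_def)
qed

lemma functional_L: "functional (\<lambda>f. L f x)"
  by (auto simp: functional_def L_add L_scale)

lemma functional_Gamma: "h \<in> A \<Longrightarrow> functional (\<lambda>f. \<Gamma> L f h x)"
  by (auto simp: functional_def Gamma_add Gamma_scale)

lemma Gamma2_sym: "\<Gamma>2 L f g = \<Gamma>2 L g f"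
  by (auto simp: \<Gamma>2_def Gamma_sym[of f g])

lemma functional_Gamma2: "h \<in> A \<Longrightarrow> functional (\<lambda>f. \<Gamma>2 L f h x)"
  by (auto simp: functional_def \<Gamma>2_def Gamma_bilinear L_add L_scale field_simps)

lemma functional_Hess_base: "g \<in> A \<Longrightarrow> h \<in> A \<Longrightarrow> functional (\<lambda>f. Hess L f g h x)"
  by (auto simp: functional_def Hess_def Gamma_bilinear field_simps)

lemma functional_Hess: "f \<in> A \<Longrightarrow> h \<in> A \<Longrightarrow> functional (\<lambda>g. Hess L f g h x)"
  by (auto simp: functional_def Hess_def Gamma_bilinear field_simps)

lemma Hess_sym: "Hess L f g h = Hess L f h g"
  by (auto simp: Hess_def Gamma_sym[of g h])

section \<open>Perturbations of second order\<close>

text \<open>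
  These are \<open>(g - g(x)) k\<close> and \<open>(g - g(x)) (h - h(x)) - g(x) h(x)\<close>.  Since \<open>A\<close> need not contain
  the constants, the products are expanded and the constant is dropped; the form with sums and
  scalar multiples exhibits membership in \<open>A\<close>.
\<close>

definition centred :: "'a \<Rightarrow> ('a \<Rightarrow> real) \<Rightarrow> ('a \<Rightarrow> real) \<Rightarrow> 'a \<Rightarrow> real" where
  "centred x g k = (\<lambda>y. g y * k y + (- g x) * k y)"

definition quad :: "'a \<Rightarrow> ('a \<Rightarrow> real) \<Rightarrow> ('a \<Rightarrow> real) \<Rightarrow> 'a \<Rightarrow> real" where
  "quad x g h = (\<lambda>y. g y * h y + ((- g x) * h y + (- h x) * g y))"

lemma centred_mem [simp]: "g \<in> A \<Longrightarrow> k \<in> A \<Longrightarrow> centred x g k \<in> A"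
  unfolding centred_def by (intro add_mem mult_mem scale_mem)

lemma quad_mem [simp]: "g \<in> A \<Longrightarrow> h \<in> A \<Longrightarrow> quad x g h \<in> A"
  unfolding quad_def by (intro add_mem mult_mem scale_mem)

lemma L_mult: "L (\<lambda>y. f y * g y) = (\<lambda>x. f x * L g x + g x * L f x + 2 * \<Gamma> L f g x)"
  by (simp add: \<Gamma>_def fun_eq_iff field_simps)

lemma L_centred_at:
  assumes "g \<in> A" "k \<in> A"
  shows "L (centred x g k) x = k x * L g x + 2 * \<Gamma> L g k x"
  using assms
  by (simp only: centred_def L_add L_scale mult_mem scale_mem) (simp add: L_mult algebra_simps)

lemma Gamma_centred_at:
  assumes "g \<in> A" "k \<in> A" "u \<in> A"
  shows "\<Gamma> L (centred x g k) u x = k x * \<Gamma> L g u x"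
  using assms
  by (simp only: centred_def Gamma_add Gamma_scale mult_mem scale_mem)
    (simp add: Gamma_mult algebra_simps)

lemma Gamma_quad:
  assumes "g \<in> A" "h \<in> A" "u \<in> A"
  shows "\<Gamma> L (quad x g h) u = (\<lambda>y. centred x g (\<Gamma> L h u) y + centred x h (\<Gamma> L g u) y)"
  using assms
  by (simp only: quad_def centred_def Gamma_add Gamma_scale mult_mem scale_mem add_mem Gamma_mult
      fun_eq_iff) (simp add: algebra_simps)

lemma L_quad:
  assumes "g \<in> A" "h \<in> A"
  shows "L (quad x g h) = (\<lambda>y. (centred x g (L h) y + centred x h (L g) y) + 2 * \<Gamma> L g h y)"
  using assms
  by (simp only: quad_def centred_def L_add L_scale mult_mem scale_mem add_mem fun_eq_iff)
    (simp add: L_mult algebra_simps)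

lemma Gamma_quad_at:
  assumes "g \<in> A" "h \<in> A" "u \<in> A"
  shows "\<Gamma> L (quad x g h) u x = 0"
  using assms by (simp add: Gamma_quad centred_def)

lemma L_quad_at:
  assumes "g \<in> A" "h \<in> A"
  shows "L (quad x g h) x = 2 * \<Gamma> L g h x"
  using assms by (simp add: L_quad centred_def)

text \<open>
  By the Leibniz rule, \<open>\<Gamma>(quad x g h, f)\<close> and \<open>L (quad x g h)\<close> are sums of functions of the form
  \<open>centred x _ _\<close>, up to the term \<open>2 \<Gamma>(g, h)\<close>.  A further \<open>L\<close> or \<open>\<Gamma>\<close> at \<open>x\<close> must hit the
  vanishing factor, and the terms that contain \<open>L g\<close> or \<open>L h\<close> cancel; what is left is the
  definition of the Hessian.
\<close>

lemma Gamma2_quad_at: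
  assumes "f \<in> A" "g \<in> A" "h \<in> A"
  shows "\<Gamma>2 L f (quad x g h) x = 2 * Hess L f g h x"
proof -
  have "L (\<Gamma> L (quad x g h) f) x =
      \<Gamma> L h f x * L g x + 2 * \<Gamma> L g (\<Gamma> L h f) x + (\<Gamma> L g f x * L h x + 2 * \<Gamma> L h (\<Gamma> L g f) x)"
    using assms by (simp add: Gamma_quad L_add L_centred_at)
  moreover have "\<Gamma> L (L (quad x g h)) f x =
      L h x * \<Gamma> L g f x + L g x * \<Gamma> L h f x + 2 * \<Gamma> L (\<Gamma> L g h) f x"
    using assms by (simp add: L_quad Gamma_bilinear Gamma_centred_at add_mem scale_mem)
  moreover have "\<Gamma> L (quad x g h) (L f) x = 0"
    using assms by (simp add: Gamma_quad_at)
  ultimately show ?thesis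
    by (simp add: \<Gamma>2_def Hess_def Gamma_sym[of f] field_simps)
qed

lemma Hess_quad_at:
  assumes "p \<in> A" "q \<in> A" "g \<in> A" "h \<in> A"
  shows "Hess L (quad x p q) g h x = \<Gamma> L p g x * \<Gamma> L q h x + \<Gamma> L p h x * \<Gamma> L q g x"
proof -
  have *: "\<Gamma> L u (\<Gamma> L (quad x p q) v) x = \<Gamma> L p u x * \<Gamma> L q v x + \<Gamma> L p v x * \<Gamma> L q u x"
    if "u \<in> A" "v \<in> A" for u v
  proof -
    have "\<Gamma> L u (\<Gamma> L (quad x p q) v) x =
        \<Gamma> L (\<lambda>y. centred x p (\<Gamma> L q v) y + centred x q (\<Gamma> L p v) y) u x"
      using assms that by (simp only: Gamma_quad Gamma_sym[of u])
    then show ?thesis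
      using assms that by (simp add: Gamma_add Gamma_centred_at)
  qed
  have "\<Gamma> L (quad x p q) (\<Gamma> L g h) x = 0"
    using assms by (simp add: Gamma_quad_at)
  with assms show ?thesis by (simp add: Hess_def * field_simps)
qed



section \<open>Upper bounds for the Ricci tensor\<close>

lemma Ricci_le_perturbed:
  assumes f: "f \<in> A" and w: "w \<in> A" and null: "\<Gamma> L w w x = 0"
  shows "Ricci A L N f x \<le>
    ereal (\<Gamma>2 L f f x + 2 * \<Gamma>2 L f w x + \<Gamma>2 L w w x - real_of_ereal (1 / N) * (L f x + L w x)\<^sup>2)"
proof -
  define g where "g = (\<lambda>y. f y + w y)"
  have g: "g \<in> A" unfolding g_def by (intro add_mem f w)
  have "Ricci A L N f x \<le> ereal (\<Gamma>2 L g g x - real_of_ereal (1 / N) * (L g x)\<^sup>2)"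
    unfolding Ricci_def using g null by (intro INF_lower) (simp add: g_def)
  moreover have "\<Gamma>2 L g g x = \<Gamma>2 L f f x + 2 * \<Gamma>2 L f w x + \<Gamma>2 L w w x"
  proof -
    have "\<Gamma>2 L g k x = \<Gamma>2 L f k x + \<Gamma>2 L w k x" if "k \<in> A" for k
      unfolding g_def using functional_add[OF functional_Gamma2[OF that] f w] .
    then show ?thesis using f w g by (simp add: Gamma2_sym[of f g] Gamma2_sym[of w g] Gamma2_sym[of w f])
  qed
  moreover have "L g x = L f x + L w x"
    using f w by (simp add: g_def L_add)
  ultimately show ?thesis by simp
qed

text \<open>
  For \<open>w = \<Sum> a\<^sub>i\<^sub>j quad x e\<^sub>i e\<^sub>j / 2\<close> the term \<open>\<Gamma>\<^sub>2(w)\<close> is obtained from the formula for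
  \<open>\<Gamma>\<^sub>2(k, w)\<close> with \<open>k = w\<close>, since the Hessian of \<open>w\<close> at \<open>x\<close> along the frame is the matrix
  \<open>a\<close>.
\<close>

lemma Ricci_le_frame:
  fixes r :: nat
  assumes f: "f \<in> A" and e: "orthonormal_at A L x r e"
    and sym: "\<And>i j. i < r \<Longrightarrow> j < r \<Longrightarrow> a i j = a j i"
  shows "Ricci A L N f x \<le>
    ereal (\<Gamma>2 L f f x + 2 * (\<Sum>i<r. \<Sum>j<r. a i j * Hess L f (e i) (e j) x) +
      (\<Sum>i<r. \<Sum>j<r. (a i j)\<^sup>2) - real_of_ereal (1 / N) * (L f x + (\<Sum>i<r. a i i))\<^sup>2)"
proof -
  have eA: "e i \<in> A" if "i < r" for i using e that by (simp add: orthonormal_at_def)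
  have ee: "\<Gamma> L (e i) (e j) x = (if i = j then 1 else 0)" if "i < r" "j < r" for i j
    using e that by (simp add: orthonormal_at_def)
  define w where "w = (\<lambda>y. \<Sum>i<r. \<Sum>j<r. a i j / 2 * quad x (e i) (e j) y)"
  have sum_w: "T w = (\<Sum>i<r. \<Sum>j<r. a i j / 2 * T (quad x (e i) (e j)))" if "functional T" for T
    unfolding w_def by (rule functional_double_sum[OF that]) (simp add: eA)
  have wA: "w \<in> A"
    unfolding w_def by (rule functional_double_sum[OF functional_L]) (simp add: eA)
  have null: "\<Gamma> L w w x = 0"
    by (simp add: sum_w[OF functional_Gamma[OF wA]] Gamma_quad_at eA wA)
  have Lw: "L w x = (\<Sum>i<r. a i i)"
  proof -
    have "L w x = (\<Sum>i<r. \<Sum>j<r. if i = j then a i j else 0)"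
      unfolding sum_w[OF functional_L] by (intro sum.cong) (auto simp: L_quad_at eA ee)
    then show ?thesis by simp
  qed
  have \<Gamma>2_w: "\<Gamma>2 L k w x = (\<Sum>i<r. \<Sum>j<r. a i j * Hess L k (e i) (e j) x)" if "k \<in> A" for k
    using sum_w[OF functional_Gamma2[OF that]] that eA
    by (simp add: Gamma2_sym[of _ k] Gamma2_quad_at)
  have Hess_w: "Hess L w (e i) (e j) x = a i j" if ij: "i < r" "j < r" for i j
  proof -
    have "Hess L w (e i) (e j) x = (\<Sum>k<r. \<Sum>l<r. a k l / 2 *
        ((if k = i then 1 else 0) * (if l = j then 1 else 0) +
         (if k = j then 1 else 0) * (if l = i then 1 else 0)))"
      unfolding sum_w[OF functional_Hess_base[OF eA[OF ij(1)] eA[OF ij(2)]]]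
      using ij by (intro sum.cong) (auto simp: Hess_quad_at eA ee)
    \<comment> \<open>only \<open>(k, l) = (i, j)\<close> and \<open>(k, l) = (j, i)\<close> contribute, each half of \<open>a i j\<close>\<close>
    also have "\<dots> = (\<Sum>k<r. \<Sum>l<r. (if k = i then if l = j then a k l / 2 else 0 else 0) +
         (if k = j then if l = i then a k l / 2 else 0 else 0))"
      by (intro sum.cong) auto
    also have "\<dots> = (\<Sum>k<r. (if k = i then a k j / 2 else 0) + (if k = j then a k i / 2 else 0))"
    proof (intro sum.cong refl)
      fix k
      show "(\<Sum>l<r. (if k = i then if l = j then a k l / 2 else 0 else 0) +
         (if k = j then if l = i then a k l / 2 else 0 else 0)) =
         (if k = i then a k j / 2 else 0) + (if k = j then a k i / 2 else 0)"
        unfolding sum.distrib using ij by (cases "k = i"; cases "k = j") simp_all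
    qed
    also have "\<dots> = a i j"
      unfolding sum.distrib using ij sym[of i j] by simp
    finally show ?thesis .
  qed
  have "\<Gamma>2 L w w x = (\<Sum>i<r. \<Sum>j<r. (a i j)\<^sup>2)"
    by (simp add: \<Gamma>2_w[OF wA] Hess_w power2_eq_square)
  then show ?thesis
    using Ricci_le_perturbed[OF f wA null, of N] \<Gamma>2_w[OF f] Lw by simp
qed

text \<open>
  The choice \<open>a = c I - H\<^sub>f\<close>: by convexity this one-parameter family contains the minimiser of the
  previous bound over all symmetric \<open>a\<close> whenever \<open>N > r\<close>.
\<close>

lemma Ricci_le_shifted_Hess:
  fixes r :: nat
  assumes f: "f \<in> A" and e: "orthonormal_at A L x r e"
  shows "Ricci A L N f x \<le>
    ereal (\<Gamma>2 L f f x - (\<Sum>i<r. \<Sum>j<r. (Hess L f (e i) (e j) x)\<^sup>2) + c\<^sup>2 * real r -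
      real_of_ereal (1 / N) * (L f x - trace_along r e (\<lambda>g h. Hess L f g h x) + c * real r)\<^sup>2)"
proof -
  define H where "H i j = Hess L f (e i) (e j) x" for i j
  define a where "a i j = (if i = j then c else 0) - H i j" for i j
  have sym: "a i j = a j i" for i j
    by (simp add: a_def H_def Hess_sym[of f "e i" "e j"])
  have tr: "(\<Sum>i<r. a i i) = - trace_along r e (\<lambda>g h. Hess L f g h x) + c * real r"
    by (simp add: a_def trace_along_def H_def sum_subtractf)
  have "2 * (\<Sum>i<r. \<Sum>j<r. a i j * H i j) + (\<Sum>i<r. \<Sum>j<r. (a i j)\<^sup>2) =
      (\<Sum>i<r. \<Sum>j<r. (if i = j then c\<^sup>2 else 0) - (H i j)\<^sup>2)"
    unfolding sum_distrib_left sum.distrib[symmetric]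
    by (intro sum.cong) (auto simp: a_def power2_eq_square algebra_simps)
  also have "\<dots> = c\<^sup>2 * real r - (\<Sum>i<r. \<Sum>j<r. (H i j)\<^sup>2)"
    by (simp add: sum_subtractf)
  finally have "2 * (\<Sum>i<r. \<Sum>j<r. a i j * H i j) + (\<Sum>i<r. \<Sum>j<r. (a i j)\<^sup>2) =
      c\<^sup>2 * real r - (\<Sum>i<r. \<Sum>j<r. (H i j)\<^sup>2)" .
  then have eq1: "\<Gamma>2 L f f x + 2 * (\<Sum>i<r. \<Sum>j<r. a i j * H i j) + (\<Sum>i<r. \<Sum>j<r. (a i j)\<^sup>2) =
      \<Gamma>2 L f f x - (\<Sum>i<r. \<Sum>j<r. (H i j)\<^sup>2) + c\<^sup>2 * real r"
    by linarith
  have eq2: "L f x + (\<Sum>i<r. a i i) =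
      L f x - trace_along r e (\<lambda>g h. Hess L f g h x) + c * real r"
    using tr by simp
  show ?thesis
    using Ricci_le_frame[OF f e, of a N, OF sym, folded H_def] unfolding eq1 eq2 by (simp only: H_def)
qed

text \<open>
  The bound has leading coefficient \<open>r (1 - r / N)\<close> in \<open>c\<close>.  It is negative if \<open>N < r\<close>; if
  \<open>N = r\<close> the bound is affine in \<open>c\<close>, with slope \<open>2 (tr H\<^sub>f - L f)\<close>.
\<close>

lemma Ricci_eq_MInfty:
  fixes r :: nat and N :: real
  assumes f: "f \<in> A" and e: "orthonormal_at A L x r e" and N: "0 < N"
    and "N < real r \<or> (N = real r \<and> trace_along r e (\<lambda>g h. Hess L f g h x) \<noteq> L f x)"
  shows "Ricci A L (ereal N) f x = -\<infinity>"
proof -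
  define F where "F = (\<Sum>i<r. \<Sum>j<r. (Hess L f (e i) (e j) x)\<^sup>2)"
  define D where "D = L f x - trace_along r e (\<lambda>g h. Hess L f g h x)"
  define n where "n = real r"
  have \<kappa>: "real_of_ereal (1 / ereal N) = 1 / N"
    using N by (simp add: one_ereal_def)
  have n: "n > 0" using assms(3,4) by (auto simp: n_def)
  have "Ricci A L (ereal N) f x \<le> ereal ((\<Gamma>2 L f f x - F - D\<^sup>2 / N) + (- 2 * D * n / N) * c +
      (n * (1 - n / N)) * c\<^sup>2)" for c
  proof -
    have "Ricci A L (ereal N) f x \<le> ereal (\<Gamma>2 L f f x - F + c\<^sup>2 * n - 1 / N * (D + c * n)\<^sup>2)"
      using Ricci_le_shifted_Hess[OF f e, of "ereal N" c] by (simp add: \<kappa> F_def D_def n_def)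
    also have "\<Gamma>2 L f f x - F + c\<^sup>2 * n - 1 / N * (D + c * n)\<^sup>2 =
      (\<Gamma>2 L f f x - F - D\<^sup>2 / N) + (- 2 * D * n / N) * c + (n * (1 - n / N)) * c\<^sup>2"
      by (simp add: power2_eq_square algebra_simps add_divide_distrib)
    finally show ?thesis .
  qed
  then show ?thesis
  proof (rule ereal_below_unbounded_quadratic)
    show "n * (1 - n / N) < 0 \<or> n * (1 - n / N) = 0 \<and> - 2 * D * n / N \<noteq> 0"
      using assms(3,4) n by (auto simp: n_def D_def mult_less_0_iff)
  qed
qed

text \<open>
  The degenerate case of the Cauchy-Schwarz inequality: \<open>\<Gamma>(h + t g)(x)\<close> is affine in \<open>t\<close> and
  nonnegative.
\<close>

lemma Gamma_null:
  assumes g: "g \<in> A" and h: "h \<in> A" and null: "\<Gamma> L g g x = 0"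
  shows "\<Gamma> L g h x = 0"
proof -
  have "0 \<le> \<Gamma> L h h x + 2 * \<Gamma> L g h x * t + 0 * t\<^sup>2" for t
  proof -
    define u where "u = (\<lambda>y. h y + t * g y)"
    have "u \<in> A" unfolding u_def by (intro add_mem scale_mem g h)
    then have "0 \<le> \<Gamma> L u u x" by (rule Gamma_nonneg)
    also have "\<Gamma> L u u x = \<Gamma> L h h x + 2 * \<Gamma> L g h x * t + 0 * t\<^sup>2"
      using g h null by (simp add: u_def Gamma_bilinear add_mem scale_mem Gamma_sym[of h g] algebra_simps)
    finally show ?thesis .
  qed
  from quadratic_bounded_below(2)[OF this] show ?thesis by simp
qed

text \<open>
  If \<open>\<Gamma>(g)(x) = 0\<close>, then for \<open>q = quad x g h\<close> both \<open>L q(x) = 2 \<Gamma>(g, h)(x)\<close> and \<open>\<Gamma>\<^sub>2(q)(x)\<close> vanish,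
  while \<open>\<Gamma>\<^sub>2(f, q)(x) = 2 H\<^sub>f(g, h)(x)\<close> does not.
\<close>

lemma Ricci_eq_MInfty_degenerate:
  assumes f: "f \<in> A" and g: "g \<in> A" and h: "h \<in> A"
    and null: "\<Gamma> L g g x = 0" and H: "Hess L f g h x \<noteq> 0"
  shows "Ricci A L N f x = -\<infinity>"
proof -
  define q where "q = quad x g h"
  have q: "q \<in> A" using g h by (simp add: q_def)
  have gh: "\<Gamma> L g h x = 0" using Gamma_null[OF g h null] .
  have "Ricci A L N f x \<le>
    ereal ((\<Gamma>2 L f f x - real_of_ereal (1 / N) * (L f x)\<^sup>2) + (4 * Hess L f g h x) * t + 0 * t\<^sup>2)" for t
  proof -
    define w where "w = (\<lambda>y. t * q y)"
    have w: "w \<in> A" unfolding w_def by (intro scale_mem q)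
    have scale: "T w = t * T q" if "functional T" for T
      unfolding w_def using functional_scale[OF that q] .
    have "\<Gamma> L w w x = 0"
      using scale[OF functional_Gamma[OF w]] g h w by (simp add: q_def Gamma_quad_at)
    moreover have "L w x = 0"
      using scale[OF functional_L] g h gh by (simp add: q_def L_quad_at)
    moreover have \<Gamma>2_w: "\<Gamma>2 L k w x = t * (2 * Hess L k g h x)" if "k \<in> A" for k
      using scale[OF functional_Gamma2[OF that]] that g h
      by (simp add: Gamma2_sym[of _ k] q_def Gamma2_quad_at)
    moreover have "Hess L w g h x = 0"
      using scale[OF functional_Hess_base[OF g h]] g h gh null by (simp add: q_def Hess_quad_at)
    ultimately show ?thesis
      using Ricci_le_perturbed[OF f w, of x N] f w by (simp add: algebra_simps)
  qed
  then show ?thesis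
    by (rule ereal_below_unbounded_quadratic) (use H in simp)
qed



section \<open>The tangent space\<close>

lemma orthogonal_imp_independent:
  fixes r :: nat
  assumes e: "\<And>i. i < r \<Longrightarrow> e i \<in> A"
    and orth: "\<And>i j. i < r \<Longrightarrow> j < r \<Longrightarrow> i \<noteq> j \<Longrightarrow> \<Gamma> L (e i) (e j) x = 0"
    and nonnull: "\<And>i. i < r \<Longrightarrow> \<Gamma> L (e i) (e i) x \<noteq> 0"
  shows "independent_at A L x r e"
  unfolding independent_at_def
proof (intro conjI allI impI)
  fix c :: "nat \<Rightarrow> real" and k
  define s where "s = (\<lambda>y. \<Sum>i<r. c i * e i y)"
  assume "\<Gamma> L (\<lambda>y. \<Sum>i<r. c i * e i y) (\<lambda>y. \<Sum>i<r. c i * e i y) x = 0" and k: "k < r"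
  moreover have "s \<in> A" unfolding s_def using e by (rule sum_mem)
  ultimately have "\<Gamma> L s (e k) x = 0"
    using e by (auto simp: s_def intro: Gamma_null)
  moreover have "\<Gamma> L s (e k) x = (\<Sum>i<r. c i * \<Gamma> L (e i) (e k) x)"
    unfolding s_def by (rule Gamma_sum[OF e[OF k] e])
  moreover have "\<dots> = (\<Sum>i<r. if i = k then c i * \<Gamma> L (e i) (e i) x else 0)"
    using orth k by (intro sum.cong) auto
  ultimately show "c k = 0" using k nonnull[OF k] by simp
qed (use e in auto)

lemma independent_le_dim: "independent_at A L x r e \<Longrightarrow> enat r \<le> dim_at A L x"
  unfolding dim_at_def by (rule Sup_upper) auto

lemma orthonormal_le_dim:
  assumes "orthonormal_at A L x r e"
  shows "enat r \<le> dim_at A L x"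
  by (rule independent_le_dim[OF orthogonal_imp_independent[of r e]])
    (use assms in \<open>auto simp: orthonormal_at_def\<close>)

text \<open>
  \<open>v\<close> minus its orthogonal projection onto the span of the frame.
\<close>

definition residual :: "'a \<Rightarrow> nat \<Rightarrow> (nat \<Rightarrow> 'a \<Rightarrow> real) \<Rightarrow> ('a \<Rightarrow> real) \<Rightarrow> 'a \<Rightarrow> real" where
  "residual x r e v = (\<lambda>y. v y + (\<Sum>i<r. (- \<Gamma> L v (e i) x) * e i y))"

lemma residual:
  assumes e: "orthonormal_at A L x r e" and v: "v \<in> A"
  shows "residual x r e v \<in> A"
    and "k < r \<Longrightarrow> \<Gamma> L (residual x r e v) (e k) x = 0"
    and "\<Gamma> L (residual x r e v) (residual x r e v) x = \<Gamma> L v v x - (\<Sum>i<r. (\<Gamma> L v (e i) x)\<^sup>2)"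
    and "functional T \<Longrightarrow> T (residual x r e v) = T v - (\<Sum>i<r. \<Gamma> L v (e i) x * T (e i))"
proof -
  have eA: "e i \<in> A" if "i < r" for i using e that by (simp add: orthonormal_at_def)
  define s where "s = (\<lambda>y. \<Sum>i<r. (- \<Gamma> L v (e i) x) * e i y)"
  have s: "s \<in> A" unfolding s_def using eA by (rule sum_mem)
  have p_eq: "residual x r e v = (\<lambda>y. v y + s y)" by (simp only: residual_def s_def)
  show p: "residual x r e v \<in> A"
    unfolding p_eq by (intro add_mem v s)
  show T: "T (residual x r e v) = T v - (\<Sum>i<r. \<Gamma> L v (e i) x * T (e i))" if "functional T" for T
  proof -
    have "T s = (\<Sum>i<r. (- \<Gamma> L v (e i) x) * T (e i))"
      unfolding s_def by (rule functional_sum[OF that eA])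
    then show ?thesis
      unfolding p_eq functional_add[OF that v s] by (simp add: sum_negf)
  qed
  show orth: "\<Gamma> L (residual x r e v) (e k) x = 0" if k: "k < r" for k
  proof -
    have "(\<Sum>i<r. \<Gamma> L v (e i) x * \<Gamma> L (e i) (e k) x) = (\<Sum>i<r. if i = k then \<Gamma> L v (e i) x else 0)"
      using e k by (intro sum.cong) (auto simp: orthonormal_at_def)
    then show ?thesis using T[OF functional_Gamma[OF eA[OF k]]] k by simp
  qed
  show "\<Gamma> L (residual x r e v) (residual x r e v) x = \<Gamma> L v v x - (\<Sum>i<r. (\<Gamma> L v (e i) x)\<^sup>2)"
  proof -
    have "\<Gamma> L (e i) (residual x r e v) x = 0" if "i < r" for i
      using orth[OF that] Gamma_sym by metis
    then have "\<Gamma> L (residual x r e v) (residual x r e v) x = \<Gamma> L v (residual x r e v) x"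
      using T[OF functional_Gamma[OF p]] by simp
    also have "\<dots> = \<Gamma> L (residual x r e v) v x" by (rule Gamma_sym[THEN fun_cong])
    also have "\<dots> = \<Gamma> L v v x - (\<Sum>i<r. (\<Gamma> L v (e i) x)\<^sup>2)"
      using T[OF functional_Gamma[OF v]] by (simp add: Gamma_sym[of "e _" v] power2_eq_square)
    finally show ?thesis .
  qed
qed

lemma bessel_inequality:
  assumes "orthonormal_at A L x r e" "v \<in> A"
  shows "(\<Sum>i<r. (\<Gamma> L v (e i) x)\<^sup>2) \<le> \<Gamma> L v v x"
  using residual(3)[OF assms] Gamma_nonneg[OF residual(1)[OF assms], of x] by simp

text \<open>
  An orthonormal family of length equal to the dimension spans the tangent space, since a residual
  of positive length would extend it to a longer independent family.
\<close>

lemma residual_null: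
  assumes dim: "dim_at A L x = enat n" and e: "orthonormal_at A L x n e" and v: "v \<in> A"
  shows "\<Gamma> L (residual x n e v) (residual x n e v) x = 0"
proof (rule ccontr)
  define p where "p = residual x n e v"
  assume "\<Gamma> L (residual x n e v) (residual x n e v) x \<noteq> 0"
  then have pp: "\<Gamma> L p p x \<noteq> 0" by (simp add: p_def)
  have p: "p \<in> A" "\<And>k. k < n \<Longrightarrow> \<Gamma> L p (e k) x = 0"
    unfolding p_def by (rule residual[OF e v], rule residual(2)[OF e v])
  define e' where "e' i = (if i < n then e i else p)" for i
  have "independent_at A L x (Suc n) e'"
  proof (rule orthogonal_imp_independent)
    show "e' i \<in> A" if "i < Suc n" for i
      using e p(1) by (simp add: e'_def orthonormal_at_def)
    show "\<Gamma> L (e' i) (e' j) x = 0" if "i < Suc n" "j < Suc n" "i \<noteq> j" for i j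
      using e p(2) that Gamma_sym[of "e i" p] by (auto simp: e'_def orthonormal_at_def)
    show "\<Gamma> L (e' i) (e' i) x \<noteq> 0" if "i < Suc n" for i
      using e pp by (simp add: e'_def orthonormal_at_def)
  qed
  from independent_le_dim[OF this] dim show False by simp
qed

text \<open>
  A functional that vanishes on null functions is represented by
  \<open>w = \<Sum> T(e\<^sub>k) e\<^sub>k\<close>, that is \<open>T(g) = \<Gamma>(w, g)(x)\<close>.  The right-hand side is \<open>\<Gamma>(w)(x)\<close>, so the
  claim is Bessel's inequality for \<open>w\<close> and the family \<open>u\<close>.
\<close>

lemma functional_bessel:
  assumes dim: "dim_at A L x = enat n" and e: "orthonormal_at A L x n e"
    and u: "orthonormal_at A L x r u" and T: "functional T"
    and null: "\<And>g. g \<in> A \<Longrightarrow> \<Gamma> L g g x = 0 \<Longrightarrow> T g = 0"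
  shows "(\<Sum>j<r. (T (u j))\<^sup>2) \<le> (\<Sum>k<n. (T (e k))\<^sup>2)"
proof -
  have eA: "e i \<in> A" if "i < n" for i using e that by (simp add: orthonormal_at_def)
  define w where "w = (\<lambda>y. \<Sum>k<n. T (e k) * e k y)"
  have w: "w \<in> A" unfolding w_def using eA by (rule sum_mem)
  have Gamma_w: "\<Gamma> L w g x = (\<Sum>k<n. T (e k) * \<Gamma> L (e k) g x)" if "g \<in> A" for g
    unfolding w_def by (rule Gamma_sum[OF that eA])
  have riesz: "\<Gamma> L w g x = T g" if g: "g \<in> A" for g
  proof -
    have "T g = (\<Sum>k<n. \<Gamma> L g (e k) x * T (e k))"
      using null[OF residual(1)[OF e g] residual_null[OF dim e g]] residual(4)[OF e g T] by simp
    then show ?thesis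
      using Gamma_w[OF g] by (simp add: Gamma_sym[of _ g] mult.commute)
  qed
  have "(\<Sum>j<r. (T (u j))\<^sup>2) = (\<Sum>j<r. (\<Gamma> L w (u j) x)\<^sup>2)"
    using u by (intro sum.cong) (auto simp: riesz orthonormal_at_def)
  also have "\<dots> \<le> \<Gamma> L w w x" by (rule bessel_inequality[OF u w])
  also have "\<dots> = (\<Sum>k<n. T (e k) * \<Gamma> L (e k) w x)"
    by (rule Gamma_w[OF w])
  also have "\<dots> = (\<Sum>k<n. (T (e k))\<^sup>2)"
    using eA riesz by (intro sum.cong) (auto simp: Gamma_sym[of _ w] power2_eq_square)
  finally show ?thesis .
qed


section \<open>The Hilbert-Schmidt norm\<close>

lemma HS_norm_upper:
  "orthonormal_at A L x r e \<Longrightarrow> ereal (sqrt (\<Sum>i<r. \<Sum>j<r. (B (e i) (e j))\<^sup>2)) \<le> HS_norm A L x B"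
  unfolding HS_norm_def by (rule Sup_upper) blast

lemma HS_norm_nonneg: "0 \<le> HS_norm A L x B"
  using HS_norm_upper[of x 0 "\<lambda>_ _. 0" B] by (simp add: orthonormal_at_def zero_ereal_def)

lemma le_minus_HS_norm_square:
  fixes R :: ereal and G :: real
  assumes le: "\<And>r e. orthonormal_at A L x r e \<Longrightarrow>
      R \<le> ereal (G - (\<Sum>i<r. \<Sum>j<r. (B (e i) (e j))\<^sup>2))"
  shows "R \<le> ereal G - (HS_norm A L x B)\<^sup>2"
proof (cases R)
  case (real \<rho>)
  have bound: "(\<Sum>i<r. \<Sum>j<r. (B (e i) (e j))\<^sup>2) \<le> G - \<rho>" if "orthonormal_at A L x r e" for r e
    using le[OF that] real by simp
  from bound[of 0 "\<lambda>_ _. 0"] have "0 \<le> G - \<rho>" by (simp add: orthonormal_at_def)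
  have "HS_norm A L x B \<le> ereal (sqrt (G - \<rho>))"
    unfolding HS_norm_def by (rule Sup_least) (auto dest: bound)
  with HS_norm_nonneg[of x B] obtain h where h: "HS_norm A L x B = ereal h" "0 \<le> h" "h \<le> sqrt (G - \<rho>)"
    by (cases "HS_norm A L x B") auto
  then have "h\<^sup>2 \<le> G - \<rho>"
    using \<open>0 \<le> G - \<rho>\<close> by (metis power_mono real_sqrt_pow2)
  then show ?thesis by (simp add: real h(1))
next
  case PInf
  \<comment> \<open>impossible, because the empty family gives \<open>R \<le> G\<close>\<close>
  then show ?thesis using le[of 0 "\<lambda>_ _. 0"] by (simp add: orthonormal_at_def)
qed simp

text \<open>
  Linearity in the second argument follows from the symmetry.
\<close>

definition symmetric_form :: "(('a \<Rightarrow> real) \<Rightarrow> ('a \<Rightarrow> real) \<Rightarrow> real) \<Rightarrow> bool" where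
  "symmetric_form B \<longleftrightarrow>
    (\<forall>h\<in>A. functional (\<lambda>g. B g h)) \<and> (\<forall>g\<in>A. \<forall>h\<in>A. B g h = B h g)"

text \<open>
  For a symmetric bilinear form this means that it is well defined on the tangent space at \<open>x\<close>.
\<close>

definition descends :: "'a \<Rightarrow> (('a \<Rightarrow> real) \<Rightarrow> ('a \<Rightarrow> real) \<Rightarrow> real) \<Rightarrow> bool" where
  "descends x B \<longleftrightarrow> (\<forall>g\<in>A. \<forall>h\<in>A. \<Gamma> L g g x = 0 \<longrightarrow> B g h = 0)"

lemma symmetric_form_line:
  assumes B: "symmetric_form B" and u: "u \<in> A" and g: "g \<in> A"
  shows "B (\<lambda>y. u y + t * g y) (\<lambda>y. u y + t * g y) = B u u + (2 * B u g) * t + B g g * t\<^sup>2"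
proof -
  define v where "v = (\<lambda>y. u y + t * g y)"
  have v: "v \<in> A" unfolding v_def by (intro add_mem scale_mem u g)
  have lin: "B v k = B u k + t * B g k" if "k \<in> A" for k
  proof -
    have "functional (\<lambda>g. B g k)" using B that by (simp add: symmetric_form_def)
    from functional_add[OF this u scale_mem[OF g, of t]] functional_scale[OF this g, of t]
    show ?thesis by (simp add: v_def)
  qed
  have "B v v = B v u + t * B v g"
    using lin[OF v] B u g v by (simp add: symmetric_form_def)
  also have "\<dots> = B u u + (2 * B u g) * t + B g g * t\<^sup>2"
    using lin[OF u] lin[OF g] B u g by (simp add: symmetric_form_def power2_eq_square algebra_simps)
  finally show ?thesis by (simp add: v_def)
qed

text \<open>
  Suppose the norm is \<open>K < \<infinity>\<close>.  If \<open>u\<close> is a unit vector and \<open>g\<close> is null, then \<open>u + t g\<close> is a unit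
  vector for every \<open>t\<close>, so the quadratic polynomial \<open>B(u + t g, u + t g)\<close> in \<open>t\<close> is bounded in
  absolute value by \<open>K\<close> and hence constant: \<open>B(u, g) = 0\<close> and \<open>B(g, g) = 0\<close>.  By scaling and polarisation \<open>B\<close>
  descends.  Without a unit vector the argument fails, and indeed the norm is then \<open>0\<close>.
\<close>

lemma HS_norm_eq_PInfty:
  assumes B: "symmetric_form B" and u0: "u0 \<in> A" "\<Gamma> L u0 u0 x = 1" and "\<not> descends x B"
  shows "HS_norm A L x B = \<infinity>"
proof (rule ccontr)
  assume "HS_norm A L x B \<noteq> \<infinity>"
  with HS_norm_nonneg[of x B] obtain K where K: "HS_norm A L x B = ereal K"
    by (cases "HS_norm A L x B") auto
  have bound: "\<bar>B u u\<bar> \<le> K" if "u \<in> A" "\<Gamma> L u u x = 1" for u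
    using HS_norm_upper[of x 1 "\<lambda>_. u" B] that K by (simp add: orthonormal_at_def)
  have unit: "B u g = 0 \<and> B g g = 0"
    if u: "u \<in> A" "\<Gamma> L u u x = 1" and g: "g \<in> A" "\<Gamma> L g g x = 0" for u g
  proof -
    have line: "\<bar>B u u + (2 * B u g) * t + B g g * t\<^sup>2\<bar> \<le> K" for t
    proof -
      define v where "v = (\<lambda>y. u y + t * g y)"
      have v: "v \<in> A" unfolding v_def by (intro add_mem scale_mem u g)
      have "\<Gamma> L v v x = 1"
        using u g Gamma_null[OF g(1) u(1) g(2)]
        by (simp add: v_def Gamma_bilinear add_mem scale_mem Gamma_sym[of u g])
      from bound[OF v this] show ?thesis
        by (simp add: v_def symmetric_form_line[OF B u(1) g(1)])
    qed
    have lower: "- K \<le> B u u + (2 * B u g) * t + B g g * t\<^sup>2"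
      and upper: "- K \<le> - B u u + (- (2 * B u g)) * t + (- B g g) * t\<^sup>2" for t
      using line[of t] by auto
    have "B g g = 0"
      using quadratic_bounded_below(1)[OF lower] quadratic_bounded_below(1)[OF upper] by simp
    with quadratic_bounded_below(2)[OF lower] show ?thesis by simp
  qed
  have "descends x B"
    unfolding descends_def
  proof (intro ballI impI)
    fix g h assume g: "g \<in> A" "\<Gamma> L g g x = 0" and h: "h \<in> A"
    show "B g h = 0"
    proof (cases "\<Gamma> L h h x = 0")
      case True
      define v where "v = (\<lambda>y. g y + 1 * h y)"
      have v: "v \<in> A" unfolding v_def by (intro add_mem scale_mem g h)
      have "\<Gamma> L v v x = 0"
        using g h True Gamma_null[OF g(1) h g(2)]
        by (simp add: v_def Gamma_bilinear add_mem Gamma_sym[of h g])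
      with v have "B v v = 0" using unit[OF u0] by blast
      moreover have "B v v = B g g + (2 * B g h) * 1 + B h h * 1\<^sup>2"
        unfolding v_def by (rule symmetric_form_line[OF B g(1) h])
      moreover have "B g g = 0" "B h h = 0" using unit[OF u0] g h True by blast+
      ultimately show ?thesis by simp
    next
      case False
      define q where "q = \<Gamma> L h h x"
      have q: "q > 0" using False Gamma_nonneg[OF h, of x] by (simp add: q_def)
      define u where "u = (\<lambda>y. 1 / sqrt q * h y)"
      have u: "u \<in> A" unfolding u_def by (intro scale_mem h)
      have "\<Gamma> L u u x = 1 / sqrt q * (1 / sqrt q * q)"
        unfolding u_def using h by (simp only: Gamma_bilinear scale_mem q_def)
      then have "\<Gamma> L u u x = 1" using q by simp
      then have "B u g = 0" using unit u g by blast
      moreover have "functional (\<lambda>k. B k g)" using B g by (simp add: symmetric_form_def)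
      then have "B u g = 1 / sqrt q * B h g" unfolding u_def by (rule functional_scale[OF _ h])
      ultimately show ?thesis using B g h q by (simp add: symmetric_form_def)
    qed
  qed
  with assms(4) show False by blast
qed

text \<open>
  The supremum is attained at \<open>e\<close>: \<open>functional_bessel\<close> allows each argument of \<open>B\<close> in turn to be
  moved from another orthonormal family to \<open>e\<close>.  In dimension \<open>0\<close> only the empty family is
  orthonormal.
\<close>

lemma HS_norm_eq_Frobenius:
  assumes dim: "dim_at A L x = enat n" and e: "orthonormal_at A L x n e"
    and B: "symmetric_form B" and desc: "n = 0 \<or> descends x B"
  shows "HS_norm A L x B = ereal (sqrt (\<Sum>i<n. \<Sum>j<n. (B (e i) (e j))\<^sup>2))"
proof (rule antisym)
  have "(\<Sum>i<r. \<Sum>j<r. (B (u i) (u j))\<^sup>2) \<le> (\<Sum>i<n. \<Sum>j<n. (B (e i) (e j))\<^sup>2)"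
    if u: "orthonormal_at A L x r u" for r u
  proof (cases "n = 0")
    case True
    with orthonormal_le_dim[OF u] dim show ?thesis by (simp add: zero_enat_def)
  next
    case False
    with desc have null: "B g h = 0" if "g \<in> A" "h \<in> A" "\<Gamma> L g g x = 0" for g h
      using that by (auto simp: descends_def)
    have uA: "u i \<in> A" if "i < r" for i using u that by (simp add: orthonormal_at_def)
    have eA: "e i \<in> A" if "i < n" for i using e that by (simp add: orthonormal_at_def)
    have step: "(\<Sum>i<r. (B (u i) h)\<^sup>2) \<le> (\<Sum>k<n. (B (e k) h)\<^sup>2)" if "h \<in> A" for h
      using B null that by (intro functional_bessel[OF dim e u]) (auto simp: symmetric_form_def)
    have "(\<Sum>i<r. \<Sum>j<r. (B (u i) (u j))\<^sup>2) \<le> (\<Sum>i<r. \<Sum>k<n. (B (e k) (u i))\<^sup>2)"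
      by (subst sum.swap) (intro sum_mono step uA, simp)
    also have "\<dots> = (\<Sum>k<n. \<Sum>i<r. (B (u i) (e k))\<^sup>2)"
      using B uA eA by (subst sum.swap) (simp add: symmetric_form_def)
    also have "\<dots> \<le> (\<Sum>k<n. \<Sum>l<n. (B (e l) (e k))\<^sup>2)"
      by (intro sum_mono step eA) simp
    also have "\<dots> = (\<Sum>i<n. \<Sum>j<n. (B (e i) (e j))\<^sup>2)" by (rule sum.swap)
    finally show ?thesis .
  qed
  then show "HS_norm A L x B \<le> ereal (sqrt (\<Sum>i<n. \<Sum>j<n. (B (e i) (e j))\<^sup>2))"
    unfolding HS_norm_def by (intro Sup_least) auto
qed (rule HS_norm_upper[OF e])


end


section \<open>The last term as the parameter tends to the dimension\<close>

lemma tendsto_square_over_gap: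
  fixes g :: "real \<Rightarrow> real" and a d :: real
  assumes g: "(g \<longlongrightarrow> d) (at_right a)" and d: "d \<noteq> 0"
  shows "((\<lambda>M. ereal (1 / (M - a) * (g M)\<^sup>2)) \<longlongrightarrow> \<infinity>) (at_right a)"
proof -
  have "filterlim (\<lambda>M. inverse (M - a)) at_top (at_right a)"
  proof (rule filterlim_compose[OF filterlim_inverse_at_top_right])
    show "filterlim (\<lambda>M. M - a) (at_right 0) (at_right a)"
      unfolding filterlim_at
      by (intro conjI eventually_mono[OF eventually_at_right_less]) (auto intro!: tendsto_eq_intros)
  qed
  from filterlim_tendsto_pos_mult_at_top[OF tendsto_power[OF g, of 2] _ this] d
  show ?thesis
    by (simp add: tendsto_PInfty_eq_at_top field_simps)
qed

text \<open>The last terms in the two forms of (ii) have the same limit as \<open>M\<close> decreases to \<open>n\<close>.\<close>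

lemma tendsto_trace_defect:
  fixes n :: nat and \<tau> l :: real
  shows "((\<lambda>M. ereal (1 / (M - real n) * (\<tau> - l)\<^sup>2)) \<longlongrightarrow> (if \<tau> = l then 0 else \<infinity>))
    (at_right (real n))"
  using tendsto_square_over_gap[OF tendsto_const[of "\<tau> - l" "at_right (real n)"]]
  by (auto simp: zero_ereal_def)

lemma tendsto_weighted_trace_defect:
  fixes n :: nat and \<tau> l :: real
  assumes n: "1 \<le> n"
  shows "((\<lambda>M. ereal (1 / (M - real n) * (\<tau> - real n / M * l)\<^sup>2)) \<longlongrightarrow>
    (if \<tau> = l then 0 else \<infinity>)) (at_right (real n))"
proof (cases "\<tau> = l")
  case True
  have "((\<lambda>M. (l / M)\<^sup>2 * (M - real n)) \<longlongrightarrow> (l / real n)\<^sup>2 * (real n - real n)) (at_right (real n))"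
    using n by (intro tendsto_intros) auto
  then have lim: "((\<lambda>M. ereal ((l / M)\<^sup>2 * (M - real n))) \<longlongrightarrow> 0) (at_right (real n))"
    by (simp add: zero_ereal_def)
  have ev: "\<forall>\<^sub>F M in at_right (real n). ereal (1 / (M - real n) * (\<tau> - real n / M * l)\<^sup>2) =
      ereal ((l / M)\<^sup>2 * (M - real n))"
    using eventually_at_right_less
  proof eventually_elim
    case (elim M)
    then have "l - real n / M * l = l / M * (M - real n)" by (simp add: field_simps)
    with elim show ?case by (simp add: True power_mult_distrib power2_eq_square)
  qed
  show ?thesis
    unfolding if_P[OF True] by (rule iffD2[OF tendsto_cong[OF ev] lim])
next
  case False
  have "((\<lambda>M. \<tau> - real n / M * l) \<longlongrightarrow> \<tau> - real n / real n * l) (at_right (real n))"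
    using n by (intro tendsto_intros) auto
  then have "((\<lambda>M. \<tau> - real n / M * l) \<longlongrightarrow> \<tau> - l) (at_right (real n))" using n by simp
  from tendsto_square_over_gap[OF this] False show ?thesis by simp
qed

lemma value_or_limit_eq:
  assumes "N = real n \<Longrightarrow> ((\<lambda>M. ereal (\<phi> M)) \<longlongrightarrow> v) (at_right (real n))"
  shows "value_or_limit n N \<phi> = (if N = real n then v else ereal (\<phi> N))"
  using assms by (auto simp: value_or_limit_def intro!: tendsto_Lim)

text \<open>
  Here \<open>F\<close>, \<open>\<tau>\<close> and \<open>l\<close> stand for the squared norm of the Hessian, its trace and \<open>L f\<close>.  The
  bracket on the right is the squared norm of \<open>H\<^sub>f - (L f / N) \<Gamma>\<close>, by \<open>frame_sum_shift\<close> below.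
\<close>

lemma completed_square_identity:
  fixes N n F \<tau> l :: real
  assumes "N \<noteq> n" "N \<noteq> 0"
  shows "F + 1 / (N - n) * (\<tau> - l)\<^sup>2 =
    1 / N * l\<^sup>2 + (F - 2 * (1 / N * l) * \<tau> + (1 / N * l)\<^sup>2 * n) + 1 / (N - n) * (\<tau> - n / N * l)\<^sup>2"
proof -
  define d p A where "d = N - n" and "p = l / N" and "A = \<tau> - l"
  have d: "d \<noteq> 0" and n: "n = N - d" and l: "l = N * p"
    using assms by (auto simp: d_def p_def)
  have "\<tau> - n / N * l = A + d * p"
    using assms by (simp add: A_def n l field_simps)
  then have "1 / d * (\<tau> - n / N * l)\<^sup>2 = 1 / d * A\<^sup>2 + 2 * A * p + d * p\<^sup>2"
    using d by (simp add: power2_eq_square field_simps)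
  moreover have "1 / N * l\<^sup>2 = l * p" "1 / N * l = p" "p\<^sup>2 * n = l * p - d * p\<^sup>2"
    by (simp_all add: p_def) (use assms in \<open>simp_all add: n l power2_eq_square field_simps\<close>)
  moreover have "2 * A * p = 2 * p * \<tau> - 2 * (l * p)"
    by (simp add: A_def algebra_simps)
  ultimately show ?thesis unfolding d_def[symmetric] A_def by simp
qed

lemma ereal_sqrt_power2: "0 \<le> s \<Longrightarrow> (ereal (sqrt s))\<^sup>2 = ereal s"
  by (simp add: power2_eq_square)


section \<open>The inequalities\<close>

context diffusion_operator
begin

lemma symmetric_form_Hess: "f \<in> A \<Longrightarrow> symmetric_form (\<lambda>g h. Hess L f g h x)"
  by (auto simp: symmetric_form_def functional_Hess intro: Hess_sym[THEN fun_cong])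

lemma symmetric_form_shift:
  assumes "symmetric_form B"
  shows "symmetric_form (\<lambda>g h. B g h - c * \<Gamma> L g h x)"
  unfolding symmetric_form_def
proof (intro conjI ballI)
  fix h assume h: "h \<in> A"
  then have "functional (\<lambda>g. B g h)" using assms by (simp add: symmetric_form_def)
  then show "functional (\<lambda>g. B g h - c * \<Gamma> L g h x)"
    using h by (auto simp: functional_def Gamma_add Gamma_scale algebra_simps)
  fix g assume "g \<in> A"
  then have "B g h = B h g" using assms h by (simp add: symmetric_form_def)
  then show "B g h - c * \<Gamma> L g h x = B h g - c * \<Gamma> L h g x"
    by (simp only: Gamma_sym[of g h])
qed

lemma descends_shift: "descends x (\<lambda>g h. B g h - c * \<Gamma> L g h x) \<longleftrightarrow> descends x B"
  by (auto simp: descends_def Gamma_null)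

lemma Ricci_le_minus_HS_norm:
  assumes f: "f \<in> A"
  shows "Ricci A L \<infinity> f x \<le> ereal (\<Gamma>2 L f f x) - (HS_norm A L x (\<lambda>g h. Hess L f g h x))\<^sup>2"
  by (rule le_minus_HS_norm_square)
    (use Ricci_le_shifted_Hess[OF f, of x _ _ \<infinity> 0] in simp)

lemma frame_sum_shift:
  fixes n :: nat
  assumes e: "orthonormal_at A L x n e"
  shows "(\<Sum>i<n. \<Sum>j<n. (B (e i) (e j) - c * \<Gamma> L (e i) (e j) x)\<^sup>2) =
    (\<Sum>i<n. \<Sum>j<n. (B (e i) (e j))\<^sup>2) - 2 * c * trace_along n e B + c\<^sup>2 * real n"
proof -
  have "(\<Sum>i<n. \<Sum>j<n. (B (e i) (e j) - c * \<Gamma> L (e i) (e j) x)\<^sup>2) =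
      (\<Sum>i<n. \<Sum>j<n. (B (e i) (e j))\<^sup>2 + (if i = j then c\<^sup>2 - 2 * c * B (e i) (e j) else 0))"
    using e by (intro sum.cong) (auto simp: orthonormal_at_def power2_eq_square algebra_simps)
  also have "\<dots> = (\<Sum>i<n. \<Sum>j<n. (B (e i) (e j))\<^sup>2) + (\<Sum>i<n. c\<^sup>2 - 2 * c * B (e i) (e i))"
    by (simp add: sum.distrib)
  also have "(\<Sum>i<n. c\<^sup>2 - 2 * c * B (e i) (e i)) = c\<^sup>2 * real n - 2 * c * trace_along n e B"
    by (simp add: sum_subtractf sum_distrib_left trace_along_def)
  finally show ?thesis by simp
qed

text \<open>
  Neither side contains the Ricci tensor, so the equality holds for every symmetric form \<open>B\<close> and
  every number \<open>l\<close> in place of \<open>H\<^sub>f\<close> and \<open>L f\<close>.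
\<close>

lemma HS_norm_square_completed:
  fixes n :: nat and N :: real
  assumes N: "1 \<le> N" "real n \<le> N" and dim: "dim_at A L x = enat n"
    and e: "orthonormal_at A L x n e" and B: "symmetric_form B"
  shows "(HS_norm A L x B)\<^sup>2 + value_or_limit n N (\<lambda>M. 1 / (M - real n) * (trace_along n e B - l)\<^sup>2) =
    ereal (1 / N * l\<^sup>2) + (HS_norm A L x (\<lambda>g h. B g h - 1 / N * l * \<Gamma> L g h x))\<^sup>2 +
    value_or_limit n N (\<lambda>M. 1 / (M - real n) * (trace_along n e B - real n / M * l)\<^sup>2)"
    (is "_ + ?V1 = _ + _ + ?V2")
proof -
  define \<tau> where "\<tau> = trace_along n e B"
  define C where "C = (\<lambda>g h. B g h - 1 / N * l * \<Gamma> L g h x)"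
  define F where "F = (\<Sum>i<n. \<Sum>j<n. (B (e i) (e j))\<^sup>2)"
  have C: "symmetric_form C" unfolding C_def by (rule symmetric_form_shift[OF B])
  have V1: "?V1 = (if N = real n then if \<tau> = l then 0 else \<infinity> else ereal (1 / (N - real n) * (\<tau> - l)\<^sup>2))"
    unfolding \<tau>_def by (intro value_or_limit_eq tendsto_trace_defect)
  have V2: "?V2 = (if N = real n then if \<tau> = l then 0 else \<infinity>
      else ereal (1 / (N - real n) * (\<tau> - real n / N * l)\<^sup>2))"
    unfolding \<tau>_def using N by (intro value_or_limit_eq tendsto_weighted_trace_defect) simp
  show ?thesis
  proof (cases "n = 0 \<or> descends x B")
    case True
    then have "n = 0 \<or> descends x C" unfolding C_def descends_shift .
    then have "HS_norm A L x C = ereal (sqrt (\<Sum>i<n. \<Sum>j<n. (C (e i) (e j))\<^sup>2))"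
      by (rule HS_norm_eq_Frobenius[OF dim e C])
    then have HS: "(HS_norm A L x B)\<^sup>2 = ereal F"
        "(HS_norm A L x C)\<^sup>2 = ereal (F - 2 * (1 / N * l) * \<tau> + (1 / N * l)\<^sup>2 * real n)"
      using HS_norm_eq_Frobenius[OF dim e B True]
      by (simp_all only: F_def \<tau>_def ereal_sqrt_power2 sum_nonneg zero_le_power2
          frame_sum_shift[OF e, symmetric] C_def)
    have "F = 1 / N * l\<^sup>2 + (F - 2 * (1 / N * l) * l + (1 / N * l)\<^sup>2 * real n)" if "N = real n"
      using that N by (simp add: power2_eq_square field_simps)
    then show ?thesis
      unfolding V1 V2 HS[unfolded C_def]
      using completed_square_identity[of N "real n" F \<tau> l] N by auto
  next
    case False
    then have n: "0 < n" and "\<not> descends x B" "\<not> descends x C"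
      unfolding C_def descends_shift by auto
    have "e 0 \<in> A" "\<Gamma> L (e 0) (e 0) x = 1" using e n by (auto simp: orthonormal_at_def)
    then have "HS_norm A L x B = \<infinity>" "HS_norm A L x C = \<infinity>"
      using HS_norm_eq_PInfty B C \<open>\<not> descends x B\<close> \<open>\<not> descends x C\<close> by blast+
    moreover have "?V1 \<noteq> -\<infinity>" "?V2 \<noteq> -\<infinity>" unfolding V1 V2 by auto
    ultimately show ?thesis by (simp add: C_def)
  qed
qed

text \<open>
  If \<open>H\<^sub>f\<close> does not descend, or if \<open>N = n\<close> and \<open>tr H\<^sub>f \<noteq> L f\<close>, the Ricci tensor is \<open>-\<infinity>\<close> by the
  lemmas above.  Otherwise the norm is the Frobenius norm along \<open>e\<close>, and the claim is
  \<open>Ricci_le_shifted_Hess\<close> with \<open>c = (L f - tr H\<^sub>f) / (N - n)\<close>, respectively \<open>c = 0\<close> for \<open>N = n\<close>.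
\<close>

lemma Ricci_le_minus_completed:
  fixes n :: nat and N :: real
  assumes f: "f \<in> A" and N: "1 \<le> N" "real n \<le> N" and dim: "dim_at A L x = enat n"
    and e: "orthonormal_at A L x n e"
  defines "H \<equiv> \<lambda>g h. Hess L f g h x"
  shows "Ricci A L (ereal N) f x \<le> ereal (\<Gamma>2 L f f x) -
    ((HS_norm A L x H)\<^sup>2 + value_or_limit n N (\<lambda>M. 1 / (M - real n) * (trace_along n e H - L f x)\<^sup>2))"
    (is "_ \<le> _ - (_ + ?V)")
proof (cases "descends x H")
  case False
  then have "Ricci A L (ereal N) f x = -\<infinity>"
    using Ricci_eq_MInfty_degenerate[OF f] by (auto simp: descends_def H_def)
  then show ?thesis by simp
next
  case True
  define \<tau> where "\<tau> = trace_along n e H"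
  define F where "F = (\<Sum>i<n. \<Sum>j<n. (H (e i) (e j))\<^sup>2)"
  have HS: "(HS_norm A L x H)\<^sup>2 = ereal F"
    using HS_norm_eq_Frobenius[OF dim e symmetric_form_Hess[OF f, of x]] True
    by (simp add: F_def H_def sum_nonneg ereal_sqrt_power2)
  have V: "?V = (if N = real n then if \<tau> = L f x then 0 else \<infinity>
      else ereal (1 / (N - real n) * (\<tau> - L f x)\<^sup>2))"
    unfolding \<tau>_def by (intro value_or_limit_eq tendsto_trace_defect)
  have \<kappa>: "real_of_ereal (1 / ereal N) = 1 / N"
    using N by (simp add: one_ereal_def)
  have le: "Ricci A L (ereal N) f x \<le>
      ereal (\<Gamma>2 L f f x - F + c\<^sup>2 * real n - 1 / N * (L f x - \<tau> + c * real n)\<^sup>2)" for c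
    using Ricci_le_shifted_Hess[OF f e, of "ereal N" c] by (simp add: \<kappa> F_def \<tau>_def H_def)
  show ?thesis
  proof (cases "N = real n")
    case True
    show ?thesis
    proof (cases "\<tau> = L f x")
      case True
      with \<open>N = real n\<close> le[of 0] show ?thesis unfolding HS V by simp
    next
      case False
      then have "Ricci A L (ereal N) f x = -\<infinity>"
        using Ricci_eq_MInfty[OF f e, of N] N \<open>N = real n\<close> by (simp add: \<tau>_def H_def)
      then show ?thesis by simp
    qed
  next
    case False
    define D where "D = L f x - \<tau>"
    \<comment> \<open>the minimiser of \<open>c\<^sup>2 n - (D + c n)\<^sup>2 / N\<close>\<close>
    define c where "c = D / (N - real n)"
    have D: "D = c * (N - real n)" using False by (simp add: c_def)
    have "c\<^sup>2 * real n - 1 / N * (D + c * real n)\<^sup>2 = - (c\<^sup>2 * (N - real n))"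
      using N by (simp add: D power2_eq_square field_simps)
    also have "c\<^sup>2 * (N - real n) = 1 / (N - real n) * (\<tau> - L f x)\<^sup>2"
    proof -
      have "D\<^sup>2 = (\<tau> - L f x)\<^sup>2" by (simp add: D_def power2_commute)
      then show ?thesis using False by (simp add: c_def power_divide power2_eq_square)
    qed
    finally have eq: "\<Gamma>2 L f f x - F + c\<^sup>2 * real n - 1 / N * (D + c * real n)\<^sup>2 =
        \<Gamma>2 L f f x - (F + 1 / (N - real n) * (\<tau> - L f x)\<^sup>2)"
      by linarith
    show ?thesis
      using le[of c, folded D_def, unfolded eq] False unfolding HS V by simp
  qed
qed

text \<open>
  The supremum that defines the dimension may be infinite, so the family is obtained by
  contradiction: if all independent families had length at most \<open>N\<close>, so would the dimension.
\<close>

lemma Ricci_eq_MInfty_of_dim: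
  assumes f: "f \<in> A" and N: "1 \<le> N" "ereal N < ereal_of_enat (dim_at A L x)"
  shows "Ricci A L (ereal N) f x = -\<infinity>"
proof -
  have "\<exists>r. (\<exists>e. independent_at A L x r e) \<and> N < real r"
  proof (rule ccontr)
    assume "\<not> ?thesis"
    then have "r \<le> nat \<lfloor>N\<rfloor>" if "independent_at A L x r e" for r e
      using that by (meson le_nat_floor not_le)
    then have "dim_at A L x \<le> enat (nat \<lfloor>N\<rfloor>)"
      unfolding dim_at_def by (intro Sup_least) auto
    then have "ereal_of_enat (dim_at A L x) \<le> ereal (real (nat \<lfloor>N\<rfloor>))"
      by (cases "dim_at A L x") auto
    also have "\<dots> \<le> ereal N" using N by simp
    finally show False using N by simp
  qed
  then obtain r e where "independent_at A L x r e" "N < real r" by blast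
  moreover from this obtain u where "orthonormal_at A L x r u" using gram_schmidt by blast
  ultimately show ?thesis using Ricci_eq_MInfty[OF f, of x r u N] N by simp
qed

end

theorem theorem4p1:
  fixes A :: "('a \<Rightarrow> real) set" and L :: "('a \<Rightarrow> real) \<Rightarrow> 'a \<Rightarrow> real"
  assumes "diffusion_operator A L"
  shows
    "(\<forall>f\<in>A. \<forall>x.
       Ricci A L \<infinity> f x \<le> ereal (\<Gamma>2 L f f x) - (HS_norm A L x (\<lambda>g h. Hess L f g h x))\<^sup>2 \<and>
       (HS_norm A L x (\<lambda>g h. Hess L f g h x) = \<infinity> \<longrightarrow> Ricci A L \<infinity> f x = -\<infinity>)) \<and>
     (\<forall>x. \<forall>f\<in>A. \<forall>(N::real) (n::nat) e.
       1 \<le> N \<and> dim_at A L x = enat n \<and> real n \<le> N \<and> orthonormal_at A L x n e \<longrightarrow>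
       (let H = (\<lambda>g h. Hess L f g h x);
            tr_H = trace_along n e H;
            T1 = (\<lambda>M. 1 / (M - real n) * (tr_H - L f x)\<^sup>2);
            T2 = (\<lambda>M. 1 / (M - real n) * (tr_H - real n / M * L f x)\<^sup>2);
            S1 = (HS_norm A L x H)\<^sup>2 + value_or_limit n N T1;
            S2 = ereal (1 / N * (L f x)\<^sup>2)
                 + (HS_norm A L x (\<lambda>g h. H g h - 1 / N * L f x * \<Gamma> L g h x))\<^sup>2
                 + value_or_limit n N T2
        in Ricci A L (ereal N) f x \<le> ereal (\<Gamma>2 L f f x) - S1 \<and> S1 = S2 \<and>
           (N = real n \<longrightarrow>
              (\<exists>l\<in>{0, \<infinity>}. ((\<lambda>M. ereal (T1 M)) \<longlongrightarrow> l) (at_right (real n))) \<and>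
              (\<exists>l\<in>{0, \<infinity>}. ((\<lambda>M. ereal (T2 M)) \<longlongrightarrow> l) (at_right (real n)))))) \<and>
     (\<forall>x. \<forall>f\<in>A. \<forall>N::real. 1 \<le> N \<longrightarrow>
       (ereal N < ereal_of_enat (dim_at A L x) \<longrightarrow> Ricci A L (ereal N) f x = -\<infinity>) \<and>
       (\<forall>n e. dim_at A L x = enat n \<and> N = real n \<and> orthonormal_at A L x n e \<and>
              trace_along n e (\<lambda>g h. Hess L f g h x) \<noteq> L f x \<longrightarrow>
              Ricci A L (ereal N) f x = -\<infinity>))"
proof -
  interpret diffusion_operator A L by (rule assms)
  show ?thesis
  proof (intro conjI ballI allI impI, goal_cases)
    case (1 f x)
    then show ?case by (rule Ricci_le_minus_HS_norm)
  next
    case (2 f x)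
    then show ?case using Ricci_le_minus_HS_norm[of f x] by simp
  next
    case (3 x f N n e)
    then have N: "1 \<le> N" "real n \<le> N" and dim: "dim_at A L x = enat n"
      and e: "orthonormal_at A L x n e" by auto
    define \<tau> where "\<tau> = trace_along n e (\<lambda>g h. Hess L f g h x)"
    define v :: ereal where "v = (if \<tau> = L f x then 0 else \<infinity>)"
    have v: "v \<in> {0, \<infinity>}" by (simp add: v_def)
    have T1: "((\<lambda>M. ereal (1 / (M - real n) * (\<tau> - L f x)\<^sup>2)) \<longlongrightarrow> v) (at_right (real n))"
      unfolding v_def by (rule tendsto_trace_defect)
    have T2: "((\<lambda>M. ereal (1 / (M - real n) * (\<tau> - real n / M * L f x)\<^sup>2)) \<longlongrightarrow> v)
        (at_right (real n))" if "N = real n"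
      unfolding v_def by (rule tendsto_weighted_trace_defect) (use that N in simp)
    have ex1: "\<exists>w\<in>{0, \<infinity>}. ((\<lambda>M. ereal (1 / (M - real n) * (\<tau> - L f x)\<^sup>2)) \<longlongrightarrow> w)
        (at_right (real n))"
      using T1 v by blast
    have ex2: "\<exists>w\<in>{0, \<infinity>}. ((\<lambda>M. ereal (1 / (M - real n) * (\<tau> - real n / M * L f x)\<^sup>2)) \<longlongrightarrow> w)
        (at_right (real n))" if "N = real n"
      using T2[OF that] v by blast
    show ?case
      unfolding Let_def \<tau>_def[symmetric]
      using Ricci_le_minus_completed[OF 3(1) N dim e, folded \<tau>_def]
        HS_norm_square_completed[OF N dim e symmetric_form_Hess[OF 3(1), of x],
          where l = "L f x", folded \<tau>_def]
        ex1 ex2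
      by (intro conjI impI)
  next
    case (4 x f N)
    then show ?case by (intro Ricci_eq_MInfty_of_dim)
  next
    case (5 x f N n e)
    then show ?case by (intro Ricci_eq_MInfty[of f x n e]) auto
  qed
qed

end
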